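(* Assume that the difference equation $u_{n+1}=A_nu_n$, $n\in\mathbb{N}_0$, has the dichotomy spectrum $\Sigma_{\mathrm{ED}}=\bigcup_{i=1}^{\ell}[\sigma_i^-,\sigma_i^+]$ with fibers $\mathcal{W}_k^i$, $i=1,\ldots,\ell$, $k\in\mathbb{N}_0$. Then the upper and lower uniform outer angular values $\hat\theta_{[s]}$ and $\underline{\hat\theta}_{[s]}$, $s=1,\ldots,d$, can be represented as follows: $$\hat\theta_{[s]}=\sup_{V\in\mathcal{D}_0(s,d)}\lim_{n\to\infty}\sup_{k\in\mathbb{N}_0}\frac1n a_{k+1,k+n}(V),\qquad \underline{\hat\theta}_{[s]}=\sup_{V\in\mathcal{D}_0(s,d)}\lim_{n\to\infty}\inf_{k\in\mathbb{N}_0}\frac1n a_{k+1,k+n}(V),$$ where $\mathcal{D}_0(s,d)$ is the set of trace spaces at time $0$. The first (upper) uniform inner angular value satisfies $$\overline{\theta}_{[1]}=\max_{i=1,\ldots,\ell}\overline{\theta}_{[1]}(\mathcal{W}_0^i),\qquad\text{where}\quad \overline{\theta}_{[1]}(V)=\lim_{n\to\infty}\ \sup_{v\in V,\,v\ne0}\ \sup_{k\in\mathbb{N}_0}\frac1n a_{k+1,k+n}(v)$$ for subspaces $V\subseteq\mathbb{R}^d$.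
   Context: Setting: $A_n\in\mathbb{R}^{d,d}$, $n\in\mathbb{N}_0$, are invertible, and $\|A_n\|$, $\|A_n^{-1}\|$ are uniformly bounded in $n$. The solution operator is $\Phi(n,m)=A_{n-1}\cdots A_m$ for $n>m$, $\Phi(n,n)=I$, $\Phi(n,m)=A_n^{-1}\cdots A_{m-1}^{-1}$ for $n<m$. $\|\cdot\|$ is the Euclidean norm of vectors and the associated spectral norm; $\mathcal{R}(P)$ is the range of $P$. $\mathcal{G}(s,d)$ is the Grassmannian of $s$-dimensional subspaces of $\mathbb{R}^d$. For $V,W\in\mathcal{G}(s,d)$, $\angle(V,W)\in[0,\frac{\pi}{2}]$ is the largest principal angle between $V$ and $W$ (its cosine is the smallest singular value of $V_B^\top W_B$, where the columns of $V_B,W_B\in\mathbb{R}^{d,s}$ form orthonormal bases of $V,W$). For nonzero vectors, $\angle(v,w)=\angle(\mathrm{span}(v),\mathrm{span}(w))$. Partial sums: $a_{m,n}(V)=\sum_{j=m}^{n}\angle(\Phi(j-1,0)V,\Phi(j,0)V)$ for $m,n\in\mathbb{N}$, $V\in\mathcal{G}(s,d)$, and $a_{m,n}(v)=a_{m,n}(\mathrm{span}(v))$ for $v\in\mathbb{R}^d$, $v\ne0$. Uniform angular values (all limits below, and those in the claim, exist): upper/lower uniform outer: $\hat\theta_{[s]}=\sup_{V\in\mathcal{G}(s,d)}\lim_{n\to\infty}\frac1n\sup_{k\in\mathbb{N}_0}a_{k+1,k+n}(V)$, $\ \underline{\hat\theta}_{[s]}=\sup_{V\in\mathcal{G}(s,d)}\lim_{n\to\infty}\frac1n\inf_{k\in\mathbb{N}_0}a_{k+1,k+n}(V)$;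 upper uniform inner: $\overline{\theta}_{[s]}=\lim_{n\to\infty}\frac1n\sup_{V\in\mathcal{G}(s,d)}\sup_{k\in\mathbb{N}_0}a_{k+1,k+n}(V)$. Exponential dichotomy (ED) on $\mathbb{N}_0$ of a system with solution operator $\Psi$: there are constants $K>0$, $\alpha_s,\alpha_u\in(0,1)$ and projectors $P_n^s$, $P_n^u=I-P_n^s$ ($n\in\mathbb{N}_0$) with $P_n^{s,u}\Psi(n,m)=\Psi(n,m)P_m^{s,u}$ for all $n,m$, and $\|\Psi(n,m)P_m^s\|\le K\alpha_s^{n-m}$, $\|\Psi(m,n)P_n^u\|\le K\alpha_u^{n-m}$ for all $n\ge m$. Dichotomy spectrum: $\Sigma_{\mathrm{ED}}=\{\gamma>0: u_{n+1}=\frac1\gamma A_nu_n \text{ has no ED on }\mathbb{N}_0\}$. It is a union of $\ell\le d$ disjoint intervals $[\sigma_i^-,\sigma_i^+]$, $i=1,\ldots,\ell$, with $0<\sigma_\ell^-\le\sigma_\ell^+<\cdots<\sigma_1^-\le\sigma_1^+$. Resolvent intervals: $R_1=(\sigma_1^+,\infty)$, $R_i=(\sigma_i^+,\sigma_{i-1}^-)$ for $i=2,\ldots,\ell+1$, with $\sigma_{\ell+1}^+=0$. Dichotomy projectors: for each $i=1,\ldots,\ell+1$, the scaled systems with $\gamma\in R_i$ have an ED with projectors $P_{n,i}^s$, $P_{n,i}^u=I-P_{n,i}^s$ ($n\in\mathbb{N}_0$) not depending on the choice of $\gamma\in R_i$, which satisfy $P_{n,i}^{s,u}\Phi(n,m)=\Phi(n,m)P_{m,i}^{s,u}$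 and, with a constant $K>0$, for all $n\ge m$: $\|\Phi(n,m)P_{m,i}^s\|\le K(\sigma_i^+)^{n-m}$ for $i=1,\ldots,\ell$, and $\|\Phi(m,n)P_{n,i}^u\|\le K(\sigma_{i-1}^-)^{m-n}$ for $i=2,\ldots,\ell+1$. Their ranges form flags: for every $n$, $\{0\}=\mathcal{R}(P_{n,\ell+1}^s)\subseteq\mathcal{R}(P_{n,\ell}^s)\subseteq\cdots\subseteq\mathcal{R}(P_{n,1}^s)=\mathbb{R}^d$ and $\mathbb{R}^d=\mathcal{R}(P_{n,\ell+1}^u)\supseteq\mathcal{R}(P_{n,\ell}^u)\supseteq\cdots\supseteq\mathcal{R}(P_{n,1}^u)=\{0\}$. Spectral fibers: $\mathcal{W}_n^i=\mathcal{R}(P_{n,i}^s)\cap\mathcal{R}(P_{n,i+1}^u)$, $i=1,\ldots,\ell$. Trace spaces at time $0$: $\mathcal{D}_0(s,d)$ is the set of all $V\in\mathcal{G}(s,d)$ of the form $V=\bigoplus_{i=1}^{\ell}W_i$ with subspaces $W_i\subseteq\mathcal{W}_0^i$ and $\sum_{i=1}^\ell\dim W_i=s$. *)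

theory Defs
  imports "Jordan_Normal_Form.Char_Poly" "HOL-Analysis.Analysis"
begin

(* Clashes with HOL-Analysis; the constants remain available under qualified names. *)
hide_const (open) Matrix.mat Matrix.vec Matrix.row Matrix.col Matrix.rows Matrix.cols
  Determinant.det
no_notation vec_index (infixl \<open>$\<close> 100)
no_notation scalar_prod (infix \<open>\<bullet>\<close> 70)

section \<open>Principal angles\<close>

definition grassmannian :: "nat \<Rightarrow> (real ^ 'd) set set" where
  "grassmannian s = {V. subspace V \<and> dim V = s}"

definition orthonormal_basis :: "(real ^ 'd) set \<Rightarrow> (nat \<Rightarrow> real ^ 'd) \<Rightarrow> bool" where
  "orthonormal_basis V b \<longleftrightarrow>
     (\<forall>i<dim V. \<forall>j<dim V. b i \<bullet> b j = (if i = j then 1 else 0)) \<and> span (b ` {..<dim V}) = V"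

definition some_orthonormal_basis :: "(real ^ 'd) set \<Rightarrow> nat \<Rightarrow> real ^ 'd" where
  "some_orthonormal_basis V = (SOME b. orthonormal_basis V b)"

definition singular_values :: "real Matrix.mat \<Rightarrow> real set" where
  "singular_values M = {sqrt e | e. eigenvalue (transpose_mat M * M) e}"

text \<open>The columns \<open>b 0, \<dots>, b (s - 1)\<close> of \<open>V\<^sub>B\<close> and \<open>c 0, \<dots>, c (s - 1)\<close> of \<open>W\<^sub>B\<close> give the
  \<open>s \<times> s\<close> matrix \<open>V\<^sub>B\<^sup>T W\<^sub>B\<close> with entries \<open>b i \<bullet> c j\<close>. Changing the orthonormal bases multiplies
  it by orthogonal matrices and leaves the singular values unchanged. Only meaningful for subspaces
  of the same positive dimension.\<close>

definition principal_angle :: "(real ^ 'd) set \<Rightarrow> (real ^ 'd) set \<Rightarrow> real" where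
  "principal_angle V W =
     (let b = some_orthonormal_basis V; c = some_orthonormal_basis W
      in arccos (Min (singular_values (Matrix.mat (dim V) (dim W) (\<lambda>(i, j). b i \<bullet> c j)))))"

section \<open>Solution operator and angular values\<close>

definition spectral_norm :: "real ^ 'd ^ 'd \<Rightarrow> real" where
  "spectral_norm M = onorm ((*v) M)"

text \<open>\<open>forward_op A m k = A (m + k - 1) ** \<dots> ** A m\<close> and
  \<open>backward_op A n k = matrix_inv (A n) ** \<dots> ** matrix_inv (A (n + k - 1))\<close>.\<close>

primrec forward_op :: "(nat \<Rightarrow> real ^ 'd ^ 'd) \<Rightarrow> nat \<Rightarrow> nat \<Rightarrow> real ^ 'd ^ 'd" where
  "forward_op A m 0 = mat 1"
| "forward_op A m (Suc k) = A (m + k) ** forward_op A m k"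

primrec backward_op :: "(nat \<Rightarrow> real ^ 'd ^ 'd) \<Rightarrow> nat \<Rightarrow> nat \<Rightarrow> real ^ 'd ^ 'd" where
  "backward_op A n 0 = mat 1"
| "backward_op A n (Suc k) = backward_op A n k ** matrix_inv (A (n + k))"

definition solution_op :: "(nat \<Rightarrow> real ^ 'd ^ 'd) \<Rightarrow> nat \<Rightarrow> nat \<Rightarrow> real ^ 'd ^ 'd" where
  "solution_op A n m = (if m \<le> n then forward_op A m (n - m) else backward_op A n (m - n))"

definition angle_sum :: "(nat \<Rightarrow> real ^ 'd ^ 'd) \<Rightarrow> nat \<Rightarrow> nat \<Rightarrow> (real ^ 'd) set \<Rightarrow> real" where
  "angle_sum A m n V =
     (\<Sum>j=m..n. principal_angle ((*v) (solution_op A (j - 1) 0) ` V) ((*v) (solution_op A j 0) ` V))"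

definition upper_uniform_outer :: "(nat \<Rightarrow> real ^ 'd ^ 'd) \<Rightarrow> nat \<Rightarrow> real" where
  "upper_uniform_outer A s =
     (SUP V\<in>grassmannian s. lim (\<lambda>n. 1 / real n * (SUP k. angle_sum A (k + 1) (k + n) V)))"

definition lower_uniform_outer :: "(nat \<Rightarrow> real ^ 'd ^ 'd) \<Rightarrow> nat \<Rightarrow> real" where
  "lower_uniform_outer A s =
     (SUP V\<in>grassmannian s. lim (\<lambda>n. 1 / real n * (INF k. angle_sum A (k + 1) (k + n) V)))"

definition upper_uniform_inner :: "(nat \<Rightarrow> real ^ 'd ^ 'd) \<Rightarrow> nat \<Rightarrow> real" where
  "upper_uniform_inner A s =
     lim (\<lambda>n. 1 / real n * (SUP V\<in>grassmannian s. SUP k. angle_sum A (k + 1) (k + n) V))"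

definition upper_uniform_inner_on :: "(nat \<Rightarrow> real ^ 'd ^ 'd) \<Rightarrow> (real ^ 'd) set \<Rightarrow> real" where
  "upper_uniform_inner_on A V =
     lim (\<lambda>n. SUP v\<in>V - {0}. SUP k. 1 / real n * angle_sum A (k + 1) (k + n) (span {v}))"

section \<open>Exponential dichotomies and the dichotomy spectrum\<close>

text \<open>\<open>Q n\<close> is the stable projector at time \<open>n\<close>, \<open>mat 1 - Q n\<close> the unstable one.\<close>

definition exp_dichotomy_with ::
    "(nat \<Rightarrow> nat \<Rightarrow> real ^ 'd ^ 'd) \<Rightarrow> (nat \<Rightarrow> real ^ 'd ^ 'd) \<Rightarrow> bool" where
  "exp_dichotomy_with \<Psi> Q \<longleftrightarrow>
     (\<forall>n. Q n ** Q n = Q n) \<and>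
     (\<forall>n m. Q n ** \<Psi> n m = \<Psi> n m ** Q m) \<and>
     (\<forall>n m. (mat 1 - Q n) ** \<Psi> n m = \<Psi> n m ** (mat 1 - Q m)) \<and>
     (\<exists>K>0. \<exists>\<alpha>s\<in>{0<..<1}. \<exists>\<alpha>u\<in>{0<..<1}. \<forall>m n. m \<le> n \<longrightarrow>
        spectral_norm (\<Psi> n m ** Q m) \<le> K * \<alpha>s ^ (n - m) \<and>
        spectral_norm (\<Psi> m n ** (mat 1 - Q n)) \<le> K * \<alpha>u ^ (n - m))"

definition exp_dichotomy :: "(nat \<Rightarrow> nat \<Rightarrow> real ^ 'd ^ 'd) \<Rightarrow> bool" where
  "exp_dichotomy \<Psi> \<longleftrightarrow> (\<exists>Q. exp_dichotomy_with \<Psi> Q)"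

definition scaled :: "real \<Rightarrow> (nat \<Rightarrow> real ^ 'd ^ 'd) \<Rightarrow> nat \<Rightarrow> real ^ 'd ^ 'd" where
  "scaled \<gamma> A n = (1 / \<gamma>) *\<^sub>R A n"

definition dichotomy_spectrum :: "(nat \<Rightarrow> real ^ 'd ^ 'd) \<Rightarrow> real set" where
  "dichotomy_spectrum A = {\<gamma>. \<gamma> > 0 \<and> \<not> exp_dichotomy (solution_op (scaled \<gamma> A))}"

text \<open>The intervals are \<open>{\<sigma>m i..\<sigma>p i}\<close> for \<open>i \<in> {1..l}\<close>, in decreasing order. With the convention
  \<open>\<sigma>p (l + 1) = 0\<close>, the case \<open>i = l\<close> of the ordering gives \<open>0 < \<sigma>m l\<close>.\<close>

definition has_dichotomy_spectrum ::
    "(nat \<Rightarrow> real ^ 'd ^ 'd) \<Rightarrow> nat \<Rightarrow> (nat \<Rightarrow> real) \<Rightarrow> (nat \<Rightarrow> real) \<Rightarrow> bool" where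
  "has_dichotomy_spectrum A l \<sigma>m \<sigma>p \<longleftrightarrow>
     1 \<le> l \<and> l \<le> CARD('d) \<and> \<sigma>p (l + 1) = 0 \<and>
     (\<forall>i\<in>{1..l}. \<sigma>p (i + 1) < \<sigma>m i \<and> \<sigma>m i \<le> \<sigma>p i) \<and>
     dichotomy_spectrum A = (\<Union>i\<in>{1..l}. {\<sigma>m i..\<sigma>p i})"

definition resolvent_interval :: "(nat \<Rightarrow> real) \<Rightarrow> (nat \<Rightarrow> real) \<Rightarrow> nat \<Rightarrow> real set" where
  "resolvent_interval \<sigma>m \<sigma>p i = (if i = 1 then {\<sigma>p 1<..} else {\<sigma>p i<..<\<sigma>m (i - 1)})"

text \<open>\<open>P n i\<close> is the stable projector at time \<open>n\<close> belonging to the \<open>i\<close>-th resolvent interval.\<close>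

definition dichotomy_projectors ::
    "(nat \<Rightarrow> real ^ 'd ^ 'd) \<Rightarrow> nat \<Rightarrow> (nat \<Rightarrow> real) \<Rightarrow> (nat \<Rightarrow> real)
      \<Rightarrow> (nat \<Rightarrow> nat \<Rightarrow> real ^ 'd ^ 'd) \<Rightarrow> bool" where
  "dichotomy_projectors A l \<sigma>m \<sigma>p P \<longleftrightarrow>
     (\<forall>i\<in>{1..l + 1}. \<forall>\<gamma>\<in>resolvent_interval \<sigma>m \<sigma>p i.
        exp_dichotomy_with (solution_op (scaled \<gamma> A)) (\<lambda>n. P n i)) \<and>
     (\<forall>i\<in>{1..l + 1}. \<forall>n m.
        P n i ** solution_op A n m = solution_op A n m ** P m i \<and>
        (mat 1 - P n i) ** solution_op A n m = solution_op A n m ** (mat 1 - P m i)) \<and>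
     (\<exists>K>0. \<forall>m n. m \<le> n \<longrightarrow>
        (\<forall>i\<in>{1..l}. spectral_norm (solution_op A n m ** P m i) \<le> K * \<sigma>p i ^ (n - m)) \<and>
        (\<forall>i\<in>{2..l + 1}. spectral_norm (solution_op A m n ** (mat 1 - P n i))
            \<le> K * \<sigma>m (i - 1) powi (int m - int n))) \<and>
     (\<forall>n. range ((*v) (P n (l + 1))) = {0} \<and>
        (\<forall>i\<in>{1..l}. range ((*v) (P n (i + 1))) \<subseteq> range ((*v) (P n i))) \<and>
        range ((*v) (P n 1)) = UNIV) \<and>
     (\<forall>n. range ((*v) (mat 1 - P n (l + 1))) = UNIV \<and>
        (\<forall>i\<in>{1..l}. range ((*v) (mat 1 - P n i)) \<subseteq> range ((*v) (mat 1 - P n (i + 1)))) \<and>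
        range ((*v) (mat 1 - P n 1)) = {0})"

definition fiber :: "(nat \<Rightarrow> nat \<Rightarrow> real ^ 'd ^ 'd) \<Rightarrow> nat \<Rightarrow> nat \<Rightarrow> (real ^ 'd) set" where
  "fiber P n i = range ((*v) (P n i)) \<inter> range ((*v) (mat 1 - P n (i + 1)))"

definition is_direct_sum :: "nat set \<Rightarrow> (nat \<Rightarrow> (real ^ 'd) set) \<Rightarrow> (real ^ 'd) set \<Rightarrow> bool" where
  "is_direct_sum I W V \<longleftrightarrow>
     V = {\<Sum>i\<in>I. x i | x. \<forall>i\<in>I. x i \<in> W i} \<and>
     (\<forall>x. (\<forall>i\<in>I. x i \<in> W i) \<and> (\<Sum>i\<in>I. x i) = 0 \<longrightarrow> (\<forall>i\<in>I. x i = 0))"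

definition trace_spaces ::
    "(nat \<Rightarrow> nat \<Rightarrow> real ^ 'd ^ 'd) \<Rightarrow> nat \<Rightarrow> nat \<Rightarrow> (real ^ 'd) set set" where
  "trace_spaces P l s = {V \<in> grassmannian s. \<exists>W.
     (\<forall>i\<in>{1..l}. subspace (W i) \<and> W i \<subseteq> fiber P 0 i) \<and>
     is_direct_sum {1..l} W V \<and> (\<Sum>i\<in>{1..l}. dim (W i)) = s}"

end

theory Submission
  imports Defs
begin

text \<open>The largest principal angle of \<open>V\<close> and \<open>W\<close> is the arccosine of the minimum over unit \<open>w \<in> W\<close> of
  the maximum over unit \<open>v \<in> V\<close> of \<open>v \<bullet> w\<close>. Hence it is uniformly continuous in both arguments with
  respect to the Hausdorff distance of unit spheres, and two subspaces whose images under the solution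
  operator approach each other have the same outer angular values. All limits exist by Fekete's
  lemma.

  Outer values: at each resolvent gap, split \<open>V\<close> into its part in the range of the stable projector
  and a complement, and project the complement along the stable range. The discarded part decays
  exponentially relative to what remains. Going through all gaps deforms \<open>V\<close> into a trace space
  without changing its angular values.

  Inner values: a trajectory starting in \<open>x + y\<close>, with \<open>x\<close> in the slow fiber and \<open>y\<close> in the faster
  decaying stable range, follows \<open>y\<close> up to some time and \<open>x\<close> from then on, up to a transition whose
  length does not depend on \<open>x\<close> and \<open>y\<close>. Its angle sum is therefore at most that of a concatenation of
  a trajectory in the stable range and one in the fiber, and one inducts over the flag.\<close>

section \<open>Variational description of the principal angle\<close>

text \<open>Outer and inner values need different uniformity. For an outer value \<open>V\<close> is
  fixed: the relative error of its deformation tends to 0 at a rate depending on \<open>V\<close>,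
  so only finitely many steps, counted from time 0, are disturbed, at a cost independent of the
  window from \<open>k\<close> to \<open>k + n\<close>. For the inner value the supremum over lines
  precedes the limit and no common rate exists, since a line with a tiny component in the slow fiber
  turns to that fiber arbitrarily late. Only the length of the change is uniform, while its time
  depends on the line; hence the bounds have to hold on arbitrary windows with one additive constant
  for all lines, which is \<open>angle_growth\<close>. Angles ignore the length of vectors, so
  errors are measured relative to the current size of a solution, and of the dichotomy rates only
  the quotient across a gap enters \<open>dominated_splitting\<close>. A trivial fiber is not
  excluded explicitly; it would lead to a supremum over the empty set, so
  \<open>fib_nontrivial\<close> rules it out by means of the spectrum.\<close>

lemma orthonormal_basis_exists:
  fixes V :: "(real ^ 'd) set"
  assumes "subspace V"
  shows "\<exists>b. orthonormal_basis V b"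
proof -
  obtain B where B: "B \<subseteq> V" "pairwise real_inner_class.orthogonal B"
      "\<And>x. x \<in> B \<Longrightarrow> norm x = 1" "independent B" "card B = dim V" "span B = V"
    using orthonormal_basis_subspace[OF assms] by blast
  have "finite B" using B(4) by (rule independent_imp_finite)
  then obtain b where b: "bij_betw b {..<dim V} B"
    using ex_bij_betw_nat_finite[of B] B(5) by (auto simp: atLeast0LessThan)
  have mem: "b i \<in> B" if "i < dim V" for i using b that by (auto simp: bij_betw_def)
  have "b i \<bullet> b j = (if i = j then 1 else 0)" if "i < dim V" "j < dim V" for i j
  proof (cases "i = j")
    case True
    then show ?thesis using B(3)[OF mem[OF that(1)]] by (simp add: norm_eq_1)
  next
    case False
    then have "b i \<noteq> b j" using b that by (auto simp: bij_betw_def inj_on_def)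
    then show ?thesis using B(2) mem that False by (auto simp: pairwise_def orthogonal_def)
  qed
  moreover have "b ` {..<dim V} = B" using b by (simp add: bij_betw_def)
  ultimately show ?thesis using B(6) unfolding orthonormal_basis_def by blast
qed

lemma orthonormal_basis_some:
  "subspace V \<Longrightarrow> orthonormal_basis V (some_orthonormal_basis V)"
  unfolding some_orthonormal_basis_def by (rule someI_ex[OF orthonormal_basis_exists])

lemma orthonormal_basis_expand:
  assumes "orthonormal_basis V b" "w \<in> V"
  shows "w = (\<Sum>j<dim V. (b j \<bullet> w) *\<^sub>R b j)"
proof -
  have on: "\<And>i j. i < dim V \<Longrightarrow> j < dim V \<Longrightarrow> b i \<bullet> b j = (if i = j then 1 else 0)"
    and "w \<in> span (b ` {..<dim V})"
    using assms by (auto simp: orthonormal_basis_def)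
  from this(2) show ?thesis
  proof (induction rule: span_induct_alt)
    case base then show ?case by simp
  next
    case (step c x y)
    then obtain k where k: "k < dim V" "x = b k" by auto
    have "(\<Sum>j<dim V. (b j \<bullet> x) *\<^sub>R b j) = (\<Sum>j<dim V. if j = k then b j else 0)"
      by (rule sum.cong) (use on k in auto)
    also have "\<dots> = x" using k by simp
    finally have x: "(\<Sum>j<dim V. (b j \<bullet> x) *\<^sub>R b j) = x" .
    have "(\<Sum>j<dim V. (b j \<bullet> (c *\<^sub>R x + y)) *\<^sub>R b j)
      = c *\<^sub>R (\<Sum>j<dim V. (b j \<bullet> x) *\<^sub>R b j) + (\<Sum>j<dim V. (b j \<bullet> y) *\<^sub>R b j)"
      by (simp add: inner_add_right scaleR_add_left sum.distrib scaleR_sum_right)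
    then show ?case using step.IH x by metis
  qed
qed

text \<open>The orthogonal projection onto \<open>V\<close> when \<open>b\<close> is an orthonormal
  basis of \<open>V\<close>. As an explicit formula it is linear for every \<open>b\<close>.\<close>

definition basis_proj :: "(real ^ 'd) set \<Rightarrow> (nat \<Rightarrow> real ^ 'd) \<Rightarrow> real ^ 'd \<Rightarrow> real ^ 'd" where
  "basis_proj V b w = (\<Sum>i<dim V. (b i \<bullet> w) *\<^sub>R b i)"

lemma linear_basis_proj: "linear (basis_proj V b)"
  by (rule linearI) (simp_all add: basis_proj_def inner_add_right scaleR_add_left sum.distrib scaleR_sum_right)

lemma basis_proj_in: "orthonormal_basis V b \<Longrightarrow> subspace V \<Longrightarrow> basis_proj V b w \<in> V"
  unfolding basis_proj_def orthonormal_basis_def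
  by (metis (no_types, lifting) imageI span_base subspace_mul subspace_sum)

lemma basis_proj_inner: "basis_proj V b w \<bullet> u = (\<Sum>i<dim V. (b i \<bullet> w) * (b i \<bullet> u))"
  by (simp add: basis_proj_def inner_sum_left)

text \<open>Vectors of \<open>V\<close> do not see the component of \<open>w\<close> orthogonal to
  \<open>V\<close>.\<close>

lemma basis_proj_inner_sub:
  assumes "orthonormal_basis V b" "v \<in> V"
  shows "v \<bullet> w = v \<bullet> basis_proj V b w"
proof -
  have "v \<bullet> w = (\<Sum>j<dim V. (b j \<bullet> v) *\<^sub>R b j) \<bullet> w"
    using orthonormal_basis_expand[OF assms] by simp
  also have "\<dots> = v \<bullet> basis_proj V b w"
    by (simp add: inner_sum_left basis_proj_def inner_sum_right mult.commute inner_commute)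
  finally show ?thesis .
qed

lemma basis_proj_inner_proj:
  assumes "orthonormal_basis V b" "subspace V"
  shows "basis_proj V b w \<bullet> basis_proj V b u = (\<Sum>i<dim V. (b i \<bullet> w) * (b i \<bullet> u))"
  using basis_proj_inner_sub[OF assms(1) basis_proj_in[OF assms], of w u]
  by (simp add: basis_proj_inner)

text \<open>In orthonormal coordinates \<open>M\<^sup>T M\<close> is the compression to \<open>W\<close> of the orthogonal projection
  onto \<open>V\<close>.\<close>

lemma eigenvalue_gram_iff:
  fixes V W :: "(real ^ 'd) set"
  assumes V: "subspace V" "orthonormal_basis V b" and W: "subspace W" "orthonormal_basis W c"
    and M: "M = Matrix.mat (dim V) (dim W) (\<lambda>(i, j). b i \<bullet> c j)"
  shows "eigenvalue (transpose_mat M * M) e \<longleftrightarrow>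
    (\<exists>w\<in>W. w \<noteq> 0 \<and> (\<forall>u\<in>W. basis_proj V b u \<bullet> basis_proj V b w = e * (u \<bullet> w)))"
proof -
  let ?p = "basis_proj V b" and ?s = "dim W"
  have onc: "\<And>i j. i < ?s \<Longrightarrow> j < ?s \<Longrightarrow> c i \<bullet> c j = (if i = j then 1 else 0)"
    and spc: "span (c ` {..<?s}) = W" using W(2) by (auto simp: orthonormal_basis_def)
  have cW: "c j \<in> W" if "j < ?s" for j using spc that by (auto intro: span_base)
  interpret lp: linear ?p by (rule linear_basis_proj)
  have N: "transpose_mat M * M \<in> carrier_mat ?s ?s" using M by auto
  have entry: "(transpose_mat M * M) $$ (j, k) = ?p (c j) \<bullet> ?p (c k)" if "j < ?s" "k < ?s" for j k
    using that unfolding basis_proj_inner_proj[OF V(2,1)] M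
    by (simp add: scalar_prod_def atLeast0LessThan)
  have mult: "vec_index ((transpose_mat M * M) *\<^sub>v x) j
      = ?p (c j) \<bullet> ?p (\<Sum>k<?s. vec_index x k *\<^sub>R c k)"
    if x: "x \<in> carrier_vec ?s" and j: "j < ?s" for x j
  proof -
    have "vec_index ((transpose_mat M * M) *\<^sub>v x) j
      = (\<Sum>k<?s. (transpose_mat M * M) $$ (j, k) * vec_index x k)"
      using N x j by (auto simp: mult_mat_vec_def scalar_prod_def atLeast0LessThan intro!: sum.cong)
    also have "\<dots> = (\<Sum>k<?s. ?p (c j) \<bullet> ?p (c k) * vec_index x k)"
      using entry j by (auto intro!: sum.cong)
    also have "\<dots> = ?p (c j) \<bullet> ?p (\<Sum>k<?s. vec_index x k *\<^sub>R c k)"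
      by (simp add: lp.sum lp.scaleR inner_sum_right mult.commute)
    finally show ?thesis .
  qed
  have coord: "c j \<bullet> (\<Sum>k<?s. f k *\<^sub>R c k) = f j" if "j < ?s" for f j
  proof -
    have "c j \<bullet> (\<Sum>k<?s. f k *\<^sub>R c k) = (\<Sum>k<?s. if k = j then f k else 0)"
      unfolding inner_sum_right by (rule sum.cong) (use onc that in auto)
    then show ?thesis using that by simp
  qed
  show ?thesis
  proof
    assume "eigenvalue (transpose_mat M * M) e"
    then obtain x where x: "x \<in> carrier_vec ?s" "x \<noteq> 0\<^sub>v ?s"
        and ev: "(transpose_mat M * M) *\<^sub>v x = e \<cdot>\<^sub>v x"
      unfolding eigenvalue_def eigenvector_def using N by auto
    define w where "w = (\<Sum>k<?s. vec_index x k *\<^sub>R c k)"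
    have wW: "w \<in> W" unfolding w_def by (intro subspace_sum[OF W(1)] subspace_mul[OF W(1)] cW) auto
    have "w \<noteq> 0"
    proof
      assume "w = 0"
      then have "vec_index x j = 0" if "j < ?s" for j using coord[OF that, of "vec_index x"] by (simp add: w_def)
      then have "x = 0\<^sub>v ?s" using x(1) by (intro eq_vecI) auto
      with x(2) show False ..
    qed
    \<comment> \<open>Row \<open>j\<close> of the eigenvalue equation is this identity for
      \<open>u = c j\<close>, and both sides are linear in \<open>u\<close>.\<close>
    moreover have "?p u \<bullet> ?p w = e * (u \<bullet> w)" if "u \<in> W" for u
    proof -
      have b: "?p (c j) \<bullet> ?p w = e * (c j \<bullet> w)" if "j < ?s" for j
        using mult[OF x(1) that] ev x(1) that coord[OF that, of "vec_index x"] by (simp add: w_def)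
      have u: "u = (\<Sum>j<?s. (c j \<bullet> u) *\<^sub>R c j)" by (rule orthonormal_basis_expand[OF W(2) that])
      have "?p u \<bullet> ?p w = (\<Sum>j<?s. (c j \<bullet> u) * (?p (c j) \<bullet> ?p w))"
        by (subst u) (simp add: lp.sum lp.scaleR inner_sum_left)
      also have "\<dots> = e * (\<Sum>j<?s. (c j \<bullet> u) * (c j \<bullet> w))"
        using b by (simp add: sum_distrib_left algebra_simps)
      also have "(\<Sum>j<?s. (c j \<bullet> u) * (c j \<bullet> w)) = u \<bullet> w"
        by (subst (2) u) (simp add: inner_sum_left)
      finally show ?thesis .
    qed
    ultimately show "\<exists>w\<in>W. w \<noteq> 0 \<and> (\<forall>u\<in>W. ?p u \<bullet> ?p w = e * (u \<bullet> w))" using wW by blast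
  next
    assume "\<exists>w\<in>W. w \<noteq> 0 \<and> (\<forall>u\<in>W. ?p u \<bullet> ?p w = e * (u \<bullet> w))"
    then obtain w where w: "w \<in> W" "w \<noteq> 0" "\<And>u. u \<in> W \<Longrightarrow> ?p u \<bullet> ?p w = e * (u \<bullet> w)" by blast
    define x where "x = Matrix.vec ?s (\<lambda>j. c j \<bullet> w)"
    have x: "x \<in> carrier_vec ?s" by (simp add: x_def)
    have xj: "vec_index x j = c j \<bullet> w" if "j < ?s" for j using that by (simp add: x_def)
    have weq: "(\<Sum>k<?s. vec_index x k *\<^sub>R c k) = w"
      using orthonormal_basis_expand[OF W(2) w(1)] xj by simp
    have "x \<noteq> 0\<^sub>v ?s" using weq w(2) by auto
    moreover have "(transpose_mat M * M) *\<^sub>v x = e \<cdot>\<^sub>v x"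
    proof (rule eq_vecI)
      fix j assume "j < dim_vec (e \<cdot>\<^sub>v x)"
      then have j: "j < ?s" by (simp add: x_def)
      show "vec_index ((transpose_mat M * M) *\<^sub>v x) j = vec_index (e \<cdot>\<^sub>v x) j"
        using mult[OF x j] w(3)[OF cW[OF j]] x j weq by (simp add: xj)
    qed (use N x in auto)
    ultimately show "eigenvalue (transpose_mat M * M) e"
      unfolding eigenvalue_def eigenvector_def using N x by (intro exI[of _ x]) (auto simp: M)
  qed
qed

lemma finite_eigenvalues:
  fixes A :: "real Matrix.mat"
  assumes "A \<in> carrier_mat n n"
  shows "finite {e. eigenvalue A e}"
proof -
  have "char_poly A \<noteq> 0" using degree_monic_char_poly[OF assms] by auto
  then show ?thesis using poly_roots_finite by (simp add: eigenvalue_root_char_poly[OF assms])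
qed

text \<open>The smallest singular value is the minimum \<open>m\<close> of
  \<open>norm (basis_proj V b w)\<close> over unit \<open>w\<close> in \<open>W\<close>, and this
  norm is in turn the maximum of \<open>v \<bullet> w\<close> over unit \<open>v\<close> in
  \<open>V\<close>. The minmax is recorded as two one-sided bounds with witnesses, the form in which
  the perturbation argument uses it.\<close>

lemma principal_angle_minmax:
  fixes V W :: "(real ^ 'd) set"
  assumes V: "subspace V" and W: "subspace W" and s: "dim V \<ge> 1" "dim W \<ge> 1"
  shows "\<exists>c\<in>{0..1}. principal_angle V W = arccos c \<and>
    (\<forall>w\<in>W. norm w = 1 \<longrightarrow> (\<exists>v\<in>V. norm v = 1 \<and> c \<le> v \<bullet> w)) \<and>
    (\<exists>w\<in>W. norm w = 1 \<and> (\<forall>v\<in>V. norm v = 1 \<longrightarrow> v \<bullet> w \<le> c))"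
proof -
  define b where "b = some_orthonormal_basis V"
  define c where "c = some_orthonormal_basis W"
  have b: "orthonormal_basis V b" and c: "orthonormal_basis W c"
    using V W by (simp_all add: b_def c_def orthonormal_basis_some)
  let ?p = "basis_proj V b"
  interpret lp: linear ?p by (rule linear_basis_proj)
  define M where "M = Matrix.mat (dim V) (dim W) (\<lambda>(i, j). b i \<bullet> c j)"
  note ev = eigenvalue_gram_iff[OF V b W c M_def]
  have unit: "\<exists>v\<in>U. norm v = 1" if U: "subspace U" "dim U \<ge> 1" for U :: "(real ^ 'd) set"
  proof -
    obtain u where "u \<in> U" "u \<noteq> 0" using U(2) dim_eq_0[of U] by (metis not_one_le_zero singleton_iff subsetI)
    then show ?thesis using subspace_mul[OF U(1), of u "1 / norm u"]
      by (intro bexI[of _ "(1 / norm u) *\<^sub>R u"]) auto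
  qed
  let ?S = "{w \<in> W. norm w = 1}"
  have "?S = W \<inter> sphere 0 1" by auto
  then have "compact ?S" using closed_subspace[OF W] by (simp add: closed_Int_compact)
  moreover have "?S \<noteq> {}" using unit[OF W s(2)] by auto
  moreover have "continuous_on ?S (\<lambda>w. norm (?p w))"
    by (intro continuous_intros linear_continuous_on_compose[OF continuous_on_id linear_basis_proj])
  ultimately obtain w0 where w0: "w0 \<in> W" "norm w0 = 1"
      and min: "\<And>w. w \<in> W \<Longrightarrow> norm w = 1 \<Longrightarrow> norm (?p w0) \<le> norm (?p w)"
    using continuous_attains_inf[of ?S "\<lambda>w. norm (?p w)"] by auto
  define m where "m = norm (?p w0)"
  have ge: "m * norm w \<le> norm (?p w)" if "w \<in> W" for w
  proof (cases "w = 0")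
    case False
    have "m \<le> norm (?p ((1 / norm w) *\<^sub>R w))"
      unfolding m_def by (rule min) (use False that subspace_mul[OF W] in auto)
    then show ?thesis using False by (simp add: lp.scaleR field_simps)
  qed auto
  \<comment> \<open>First variation at the minimizer: \<open>key\<close> is a nonnegative quadratic
    in \<open>t\<close> that vanishes at 0, so its linear coefficient \<open>g\<close> is zero. Thus
    \<open>w0\<close> yields an eigenvector for the square of \<open>m\<close>.\<close>
  have stat: "?p u \<bullet> ?p w0 = m\<^sup>2 * (u \<bullet> w0)" if u: "u \<in> W" for u
  proof -
    define g where "g = ?p u \<bullet> ?p w0 - m\<^sup>2 * (u \<bullet> w0)"
    define h where "h = (norm (?p u))\<^sup>2 - m\<^sup>2 * (norm u)\<^sup>2"
    have h0: "h \<ge> 0" using power_mono[OF ge[OF u], of 2] by (simp add: h_def m_def power_mult_distrib)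
    have key: "0 \<le> 2 * t * g + t\<^sup>2 * h" for t
    proof -
      have "w0 + t *\<^sub>R u \<in> W" using w0 u W by (simp add: subspace_add subspace_mul)
      from power_mono[OF ge[OF this], of 2]
      have "m\<^sup>2 * (norm (w0 + t *\<^sub>R u))\<^sup>2 \<le> (norm (?p w0 + t *\<^sub>R ?p u))\<^sup>2"
        by (simp add: m_def power_mult_distrib lp.add lp.scaleR)
      moreover have "(norm (w0 + t *\<^sub>R u))\<^sup>2 = 1 + 2 * t * (u \<bullet> w0) + t\<^sup>2 * (norm u)\<^sup>2"
        using w0(2) unfolding power2_norm_eq_inner norm_eq_1
        by (simp add: inner_add_left inner_add_right inner_commute power2_eq_square)
      moreover have "(norm (?p w0 + t *\<^sub>R ?p u))\<^sup>2 = m\<^sup>2 + 2 * t * (?p u \<bullet> ?p w0) + t\<^sup>2 * (norm (?p u))\<^sup>2"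
        unfolding m_def power2_norm_eq_inner
        by (simp add: inner_add_left inner_add_right inner_commute power2_eq_square)
      ultimately show ?thesis by (simp add: g_def h_def algebra_simps)
    qed
    have "g = 0"
    proof (rule ccontr)
      assume "g \<noteq> 0"
      \<comment> \<open>This \<open>t\<close> makes the quadratic negative if \<open>g\<close> is
        nonzero; the denominator is \<open>h + 1\<close> because \<open>h\<close> itself may
        vanish.\<close>
      define t where "t = - g / (h + 1)"
      have t: "t * (h + 1) = - g" using h0 by (simp add: t_def)
      have "0 \<le> (2 * t * g + t\<^sup>2 * h) * (h + 1)\<^sup>2" using key by simp
      also have "\<dots> = 2 * (t * (h + 1)) * g * (h + 1) + (t * (h + 1))\<^sup>2 * h"
        by (simp add: power2_eq_square algebra_simps)
      also have "\<dots> = - (g\<^sup>2 * (h + 2))" unfolding t by (simp add: power2_eq_square algebra_simps)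
      also have "\<dots> < 0" using h0 \<open>g \<noteq> 0\<close> by simp
      finally show False by simp
    qed
    then show ?thesis by (simp add: g_def)
  qed
  have carrier: "transpose_mat M * M \<in> carrier_mat (dim W) (dim W)" by (auto simp: M_def)
  have sv: "singular_values M = sqrt ` {e. eigenvalue (transpose_mat M * M) e}"
    by (auto simp: singular_values_def)
  have "Min (singular_values M) = m"
  proof (rule Min_eqI)
    show "finite (singular_values M)" unfolding sv using finite_eigenvalues[OF carrier] by simp
    have "eigenvalue (transpose_mat M * M) (m\<^sup>2)" unfolding ev
      using w0 stat by (intro bexI[of _ w0]) auto
    then show "m \<in> singular_values M" unfolding sv by (intro image_eqI[of _ _ "m\<^sup>2"]) (auto simp: m_def)
    fix y assume "y \<in> singular_values M"
    then obtain e where e: "y = sqrt e" "eigenvalue (transpose_mat M * M) e" unfolding sv by auto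
    from e(2) obtain w where w: "w \<in> W" "w \<noteq> 0" "?p w \<bullet> ?p w = e * (w \<bullet> w)" unfolding ev by blast
    then have "m\<^sup>2 * (norm w)\<^sup>2 \<le> e * (norm w)\<^sup>2"
      using power_mono[OF ge[OF w(1)], of 2] by (simp add: m_def power_mult_distrib power2_norm_eq_inner)
    then have "m\<^sup>2 \<le> e" using w(2) by simp
    then show "m \<le> y" using e(1) real_le_rsqrt by blast
  qed
  then have pa: "principal_angle V W = arccos m"
    by (simp add: principal_angle_def Let_def M_def b_def c_def)
  have "m \<le> 1"
  proof (cases "?p w0 = 0")
    case False
    have "(norm (?p w0))\<^sup>2 = ?p w0 \<bullet> w0"
      using basis_proj_inner_sub[OF b basis_proj_in[OF b V], of w0 w0] by (simp add: power2_norm_eq_inner)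
    also have "\<dots> \<le> norm (?p w0) * norm w0" by (rule norm_cauchy_schwarz)
    finally show ?thesis using w0 False by (simp add: m_def power2_eq_square)
  qed (simp add: m_def)
  moreover have "\<exists>v\<in>V. norm v = 1 \<and> m \<le> v \<bullet> w" if w: "w \<in> W" "norm w = 1" for w
  proof (cases "?p w = 0")
    case True
    obtain v where v: "v \<in> V" "norm v = 1" using unit[OF V s(1)] by auto
    have "v \<bullet> w = 0" using basis_proj_inner_sub[OF b v(1), of w] True by simp
    moreover have "m \<le> 0" using ge[OF w(1)] w(2) True by simp
    ultimately show ?thesis using v by auto
  next
    case False
    let ?v = "(1 / norm (?p w)) *\<^sub>R ?p w"
    have vV: "?v \<in> V" by (rule subspace_mul[OF V basis_proj_in[OF b V]])
    have "?v \<bullet> w = norm (?p w)" using False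
      by (subst basis_proj_inner_sub[OF b vV]) (simp add: power2_norm_eq_inner[symmetric] power2_eq_square)
    then show ?thesis using vV False ge[OF w(1)] w(2) by (intro bexI[OF _ vV]) auto
  qed
  moreover have "v \<bullet> w0 \<le> m" if "v \<in> V" "norm v = 1" for v
    using basis_proj_inner_sub[OF b that(1), of w0] norm_cauchy_schwarz[of v "?p w0"] that(2)
    by (simp add: m_def)
  ultimately show ?thesis using pa w0 by (intro bexI[of _ m]) (auto simp: m_def)
qed

lemma principal_angle_bounds:
  fixes V W :: "(real ^ 'd) set"
  assumes "subspace V" "subspace W" "dim V \<ge> 1" "dim W \<ge> 1"
  shows "0 \<le> principal_angle V W" "principal_angle V W \<le> pi / 2"
  using principal_angle_minmax[OF assms] arccos_lbound arccos_le_pi2 by fastforce+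

section \<open>Perturbation of principal angles\<close>

definition sphere_close :: "real \<Rightarrow> 'a::real_normed_vector set \<Rightarrow> 'a set \<Rightarrow> bool" where
  "sphere_close \<delta> V V' \<longleftrightarrow>
     (\<forall>v\<in>V. norm v = 1 \<longrightarrow> (\<exists>v'\<in>V'. norm v' = 1 \<and> norm (v - v') \<le> \<delta>)) \<and>
     (\<forall>v'\<in>V'. norm v' = 1 \<longrightarrow> (\<exists>v\<in>V. norm v = 1 \<and> norm (v - v') \<le> \<delta>))"

lemma sphere_close_sym: "sphere_close \<delta> V V' \<Longrightarrow> sphere_close \<delta> V' V"
  by (auto simp: sphere_close_def norm_minus_commute)

lemma sphere_close_mono: "sphere_close \<delta> V V' \<Longrightarrow> \<delta> \<le> \<delta>' \<Longrightarrow> sphere_close \<delta>' V V'"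
  unfolding sphere_close_def by (meson order_trans)

text \<open>Normalizing doubles the error: one share is \<open>v - w\<close> itself, the other the
  difference of the two lengths. This is the origin of the factor 2 in the closeness lemmas
  below.\<close>

lemma norm_normalize_diff_le:
  fixes v w :: "'a::real_normed_vector"
  assumes "v \<noteq> 0" "w \<noteq> 0"
  shows "norm (v /\<^sub>R norm v - w /\<^sub>R norm w) * norm w \<le> 2 * norm (v - w)"
proof -
  have "norm w *\<^sub>R (v /\<^sub>R norm v - w /\<^sub>R norm w) = ((norm w - norm v) / norm v) *\<^sub>R v + (v - w)"
    using assms by (simp add: algebra_simps diff_divide_distrib divide_inverse)
  then have "norm (v /\<^sub>R norm v - w /\<^sub>R norm w) * norm w = norm (((norm w - norm v) / norm v) *\<^sub>R v + (v - w))"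
    by (metis abs_norm_cancel mult.commute norm_scaleR)
  also have "\<dots> \<le> \<bar>norm w - norm v\<bar> + norm (v - w)"
    by (rule order_trans[OF norm_triangle_ineq]) (use assms in simp)
  also have "\<bar>norm w - norm v\<bar> \<le> norm (v - w)" using norm_triangle_ineq3[of w v] by (simp add: norm_minus_commute)
  finally show ?thesis by simp
qed

text \<open>In both hypotheses the error is relative to the vector of \<open>V'\<close>, so that one
  estimate serves both directions.\<close>

lemma sphere_closeI:
  assumes sub: "subspace V" "subspace V'"
    and 1: "\<And>v. v \<in> V \<Longrightarrow> v \<noteq> 0 \<Longrightarrow> \<exists>v'\<in>V'. v' \<noteq> 0 \<and> norm (v - v') \<le> \<eta> * norm v'"
    and 2: "\<And>v'. v' \<in> V' \<Longrightarrow> v' \<noteq> 0 \<Longrightarrow> \<exists>v\<in>V. v \<noteq> 0 \<and> norm (v - v') \<le> \<eta> * norm v'"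
  shows "sphere_close (2 * \<eta>) V V'"
proof -
  have est: "norm (v /\<^sub>R norm v - w /\<^sub>R norm w) \<le> 2 * \<eta>"
    if "v \<noteq> 0" "w \<noteq> 0" "norm (v - w) \<le> \<eta> * norm w" for v w
  proof -
    have "norm (v /\<^sub>R norm v - w /\<^sub>R norm w) * norm w \<le> (2 * \<eta>) * norm w"
      using norm_normalize_diff_le[OF that(1,2)] that(3) by simp
    then show ?thesis using that(2) by simp
  qed
  have "\<exists>v'\<in>V'. norm v' = 1 \<and> norm (v - v') \<le> 2 * \<eta>" if v: "v \<in> V" "norm v = 1" for v
  proof -
    obtain w where w: "w \<in> V'" "w \<noteq> 0" "norm (v - w) \<le> \<eta> * norm w" using 1[OF v(1)] v(2) by force
    show ?thesis
      using est[OF _ w(2,3)] v w subspace_mul[OF sub(2) w(1)]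
      by (intro bexI[of _ "w /\<^sub>R norm w"]) force+
  qed
  moreover have "\<exists>v\<in>V. norm v = 1 \<and> norm (v - w) \<le> 2 * \<eta>" if w: "w \<in> V'" "norm w = 1" for w
  proof -
    obtain v where v: "v \<in> V" "v \<noteq> 0" "norm (v - w) \<le> \<eta> * norm w" using 2[OF w(1)] w(2) by force
    show ?thesis
      using est[OF v(2) _ v(3)] v w subspace_mul[OF sub(1) v(1)]
      by (intro bexI[of _ "v /\<^sub>R norm v"]) force+
  qed
  ultimately show ?thesis by (auto simp: sphere_close_def)
qed

text \<open>Take the unit vector of \<open>W'\<close> that is worst for \<open>V'\<close>, move it
  to \<open>W\<close>, choose its good partner in \<open>V\<close> and move that back to
  \<open>V'\<close>; each move costs at most \<open>\<delta>\<close> in the inner product.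
  Exchanging the roles gives the reverse inequality.\<close>

lemma minmax_cosine_perturb:
  assumes V: "sphere_close \<delta> V V'" and W: "sphere_close \<delta> W W'"
    and c: "\<forall>w\<in>W. norm w = 1 \<longrightarrow> (\<exists>v\<in>V. norm v = 1 \<and> c \<le> v \<bullet> w)"
    and c': "\<exists>w\<in>W'. norm w = 1 \<and> (\<forall>v\<in>V'. norm v = 1 \<longrightarrow> v \<bullet> w \<le> c')"
  shows "c \<le> c' + 2 * \<delta>"
proof -
  obtain w' where w': "w' \<in> W'" "norm w' = 1" and max: "\<And>v. v \<in> V' \<Longrightarrow> norm v = 1 \<Longrightarrow> v \<bullet> w' \<le> c'"
    using c' by auto
  obtain w where w: "w \<in> W" "norm w = 1" "norm (w - w') \<le> \<delta>"
    using W w' by (auto simp: sphere_close_def)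
  obtain v where v: "v \<in> V" "norm v = 1" "c \<le> v \<bullet> w" using c w by auto
  obtain v' where v': "v' \<in> V'" "norm v' = 1" "norm (v - v') \<le> \<delta>"
    using V v by (auto simp: sphere_close_def)
  have "v \<bullet> w = v' \<bullet> w' + (v - v') \<bullet> w' + v \<bullet> (w - w')" by (simp add: algebra_simps)
  moreover have "(v - v') \<bullet> w' \<le> \<delta>" using norm_cauchy_schwarz[of "v - v'" w'] w' v' by simp
  moreover have "v \<bullet> (w - w') \<le> \<delta>" using norm_cauchy_schwarz[of v "w - w'"] w v by simp
  ultimately show ?thesis using v(3) max[OF v'(1,2)] by linarith
qed

text \<open>The cosine depends linearly on the error, but arccos has infinite slope at 1, so its
  uniform continuity on the unit interval is used instead of a Lipschitz bound. With
  \<open>d / 4\<close> the cosines differ by at most \<open>d / 2\<close>, which is below the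
  modulus \<open>d\<close>.\<close>

lemma principal_angle_perturb:
  assumes "\<epsilon> > 0"
  shows "\<exists>\<delta>>0. \<forall>V V' W W' :: (real ^ 'd) set.
    subspace V \<longrightarrow> subspace V' \<longrightarrow> subspace W \<longrightarrow> subspace W' \<longrightarrow>
    1 \<le> dim V \<longrightarrow> 1 \<le> dim V' \<longrightarrow> 1 \<le> dim W \<longrightarrow> 1 \<le> dim W' \<longrightarrow>
    sphere_close \<delta> V V' \<longrightarrow> sphere_close \<delta> W W' \<longrightarrow>
    \<bar>principal_angle V W - principal_angle V' W'\<bar> \<le> \<epsilon>"
proof -
  have "uniformly_continuous_on {0..1} (arccos :: real \<Rightarrow> real)"
    by (rule compact_uniformly_continuous[OF continuous_on_subset[OF continuous_on_arccos']]) auto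
  then obtain d where d: "d > 0" "\<And>x y. x \<in> {0..1} \<Longrightarrow> y \<in> {0..1} \<Longrightarrow> \<bar>x - y\<bar> < d
      \<Longrightarrow> \<bar>arccos x - arccos y\<bar> < \<epsilon>"
    unfolding uniformly_continuous_on_def dist_real_def using assms by metis
  show ?thesis
  proof (intro exI[of _ "d / 4"] conjI allI impI)
    fix V V' W W' :: "(real ^ 'd) set"
    assume s: "subspace V" "subspace V'" "subspace W" "subspace W'"
        and dm: "1 \<le> dim V" "1 \<le> dim V'" "1 \<le> dim W" "1 \<le> dim W'"
        and cl: "sphere_close (d / 4) V V'" "sphere_close (d / 4) W W'"
    obtain c where c: "c \<in> {0..1}" "principal_angle V W = arccos c"
       "\<forall>w\<in>W. norm w = 1 \<longrightarrow> (\<exists>v\<in>V. norm v = 1 \<and> c \<le> v \<bullet> w)"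
       "\<exists>w\<in>W. norm w = 1 \<and> (\<forall>v\<in>V. norm v = 1 \<longrightarrow> v \<bullet> w \<le> c)"
      using principal_angle_minmax[OF s(1,3) dm(1,3)] by blast
    obtain c' where c': "c' \<in> {0..1}" "principal_angle V' W' = arccos c'"
       "\<forall>w\<in>W'. norm w = 1 \<longrightarrow> (\<exists>v\<in>V'. norm v = 1 \<and> c' \<le> v \<bullet> w)"
       "\<exists>w\<in>W'. norm w = 1 \<and> (\<forall>v\<in>V'. norm v = 1 \<longrightarrow> v \<bullet> w \<le> c')"
      using principal_angle_minmax[OF s(2,4) dm(2,4)] by blast
    have "c \<le> c' + 2 * (d / 4)" "c' \<le> c + 2 * (d / 4)"
      using minmax_cosine_perturb[OF cl c(3) c'(4)]
        minmax_cosine_perturb[OF cl[THEN sphere_close_sym] c'(3) c(4)] by auto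
    then have "\<bar>c - c'\<bar> < d" using d(1) by linarith
    then show "\<bar>principal_angle V W - principal_angle V' W'\<bar> \<le> \<epsilon>"
      using d(2)[OF c(1) c'(1)] c(2) c'(2) by simp
  qed (use d in simp)
qed

section \<open>Subadditive sequences\<close>

text \<open>Fekete's lemma: the limit is the infimum \<open>L\<close> of the quotients, which the
  linear lower bound keeps finite. The infimum starts at 1, because the quotient at 0 is 0 by
  convention and could lie below the limit.\<close>

lemma subadditive_convergent:
  fixes f :: "nat \<Rightarrow> real"
  assumes sub: "\<And>m n. f (m + n) \<le> f m + f n" and lower: "\<And>n. - C * real n \<le> f n"
  shows "convergent (\<lambda>n. f n / real n)"
proof -
  define L where "L = (INF n\<in>{1..}. f n / real n)"
  have bdd: "bdd_below ((\<lambda>n. f n / real n) ` {1..})"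
    using lower by (intro bdd_belowI2[where m = "- C"]) (auto simp: field_simps)
  have ge: "L \<le> f n / real n" if "n \<ge> 1" for n
    unfolding L_def by (rule cINF_lower[OF bdd]) (use that in simp)
  have mult: "f (q * m + r) \<le> real q * f m + f r" for q m r
  proof (induction q)
    case (Suc q)
    then show ?case using sub[of m "q * m + r"] by (simp add: algebra_simps)
  qed simp
  have "(\<lambda>n. f n / real n) \<longlonglongrightarrow> L"
  proof (rule LIMSEQ_I)
    fix e :: real assume e: "e > 0"
    have "\<exists>m\<in>{1..}. f m / real m < L + e / 2"
      using cInf_lessD[of "(\<lambda>n. f n / real n) ` {1..}" "L + e / 2"] e by (auto simp: L_def)
    then obtain m where m: "m \<ge> 1" "f m / real m < L + e / 2" by auto
    \<comment> \<open>Absorbs the remainder \<open>f r\<close> for every \<open>r < m\<close>, and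
      one \<open>f m\<close> for replacing \<open>real q\<close> by
      \<open>real n / real m\<close>.\<close>
    define K where "K = \<bar>f m\<bar> + (\<Sum>r<m. \<bar>f r\<bar>)"
    have K: "f n / real n \<le> L + e / 2 + K / real n" if n: "n \<ge> 1" for n
    proof -
      define q r where "q = n div m" and "r = n mod m"
      have nqr: "n = q * m + r" by (simp add: q_def r_def)
      have "r < m" using m by (simp add: r_def)
      then have fr: "f r \<le> (\<Sum>r<m. \<bar>f r\<bar>)"
        using member_le_sum[of r "{..<m}" "\<lambda>r. \<bar>f r\<bar>"] by auto
      have "- (real r / real m) * f m \<le> \<bar>(real r / real m) * f m\<bar>"
        using abs_ge_minus_self[of "(real r / real m) * f m"] by (simp only: mult_minus_left)
      also have "\<dots> \<le> 1 * \<bar>f m\<bar>" unfolding abs_mult using \<open>r < m\<close> by (intro mult_right_mono) auto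
      finally have "real q * f m \<le> real n * (f m / real m) + \<bar>f m\<bar>"
        using m by (simp add: nqr field_simps)
      then have "f n \<le> real n * (f m / real m) + K"
        using mult[of q m r] fr nqr by (simp add: K_def)
      also have "\<dots> \<le> real n * (L + e / 2) + K" using m(2) by (intro add_right_mono mult_left_mono) auto
      finally show ?thesis using n by (simp add: field_simps)
    qed
    have "(\<lambda>n. K / real n) \<longlonglongrightarrow> 0" by (rule lim_const_over_n)
    then obtain N where N: "\<And>n. n \<ge> N \<Longrightarrow> \<bar>K / real n\<bar> < e / 2"
      using e unfolding LIMSEQ_iff real_norm_def by (metis diff_zero half_gt_zero)
    show "\<exists>N. \<forall>n\<ge>N. norm (f n / real n - L) < e"
    proof (intro exI[of _ "max 1 N"] allI impI)
      fix n assume "n \<ge> max 1 N"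
      then have "n \<ge> 1" "K / real n < e / 2"
        using N[of n] abs_ge_self[of "K / real n"] by (linarith, fastforce)
      then show "norm (f n / real n - L) < e" using K[of n] ge[of n] unfolding real_norm_def by linarith
    qed
  qed
  then show ?thesis by (auto simp: convergent_def)
qed

section \<open>Dominated splittings\<close>

text \<open>Abstracts the solution operator from time 0 to time \<open>n\<close>; angle sums see no
  other starting time.\<close>

locale linear_flow =
  fixes F :: "nat \<Rightarrow> real ^ 'd \<Rightarrow> real ^ 'd"
  assumes linear_F: "linear (F n)" and inj_F: "inj (F n)" and F_0: "F 0 x = x"

text \<open>\<open>range (Q n)\<close> and the kernel of \<open>Q n\<close> are invariant under the flow \<open>F\<close>, and \<open>ratio\<close> says that
  the former is exponentially dominated by the latter.\<close>

locale dominated_splitting = linear_flow F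
  for F :: "nat \<Rightarrow> real ^ 'd \<Rightarrow> real ^ 'd" +
  fixes Q :: "nat \<Rightarrow> real ^ 'd \<Rightarrow> real ^ 'd" and K q :: real
  assumes linear_Q: "linear (Q n)" and Q_idem: "Q n (Q n x) = Q n x"
    and Q_F: "Q n (F n x) = F n (Q 0 x)" and Q_bound: "norm (Q n x) \<le> K * norm x"
    and K: "K > 0" and q: "0 \<le> q" "q < 1"
    and ratio: "\<lbrakk>Q 0 x = 0; Q 0 y = y; m \<le> n\<rbrakk> \<Longrightarrow>
      norm (F n y) * norm (F m x) \<le> K * q ^ (n - m) * (norm (F n x) * norm (F m y))"
begin

text \<open>Dropping the component in \<open>range (Q 0)\<close> on a complement of \<open>V \<inter> range (Q 0)\<close> in \<open>V\<close> changes
  solutions only by exponentially small relative errors.\<close>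

lemma extend_to_complement:
  assumes V: "subspace V" and T0: "linear T0" "inj_on T0 (V \<inter> range (Q 0))"
      "\<And>v. v \<in> V \<inter> range (Q 0) \<Longrightarrow> T0 v \<in> range (Q 0)"
    and e: "e \<longlonglongrightarrow> 0" "\<And>n v. v \<in> V \<inter> range (Q 0) \<Longrightarrow> norm (F n (T0 v - v)) \<le> e n * norm (F n (T0 v))"
  obtains T e' where "linear T" "inj_on T V" "\<And>v. v \<in> V \<inter> range (Q 0) \<Longrightarrow> T v = T0 v"
    "\<And>v. v \<in> V \<Longrightarrow> \<exists>w\<in>V \<inter> range (Q 0). Q 0 (T v) = T w \<and> T v = T w + (v - w) - Q 0 (v - w)"
    "e' \<longlonglongrightarrow> 0" "\<And>n v. v \<in> V \<Longrightarrow> norm (F n (T v - v)) \<le> e' n * norm (F n (T v))"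
proof -
  interpret Q: linear "Q n" for n by (rule linear_Q)
  interpret F: linear "F n" for n by (rule linear_F)
  interpret T0: linear T0 by (rule T0)
  let ?V0 = "V \<inter> range (Q 0)"
  have fix_Q: "Q 0 v = v" if "v \<in> range (Q 0)" for v using that Q_idem by auto
  have V0: "subspace ?V0" by (intro subspace_inter V linear_subspace_image linear_Q subspace_UNIV)
  \<comment> \<open>A linear projection onto the stable part \<open>?V0\<close> of \<open>V\<close>.
    Its kernel inside \<open>V\<close> is the complement on which \<open>T\<close> drops the
    component in \<open>range (Q 0)\<close>, while on \<open>?V0\<close> the given \<open>T0\<close>
    is kept.\<close>
  obtain \<pi> where \<pi>: "range \<pi> \<subseteq> ?V0" "linear \<pi>" "\<And>v. v \<in> ?V0 \<Longrightarrow> \<pi> v = v"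
    using linear_exists_left_inverse_on[OF linear_id V0] by (auto simp: id_def)
  interpret \<pi>: linear \<pi> by (rule \<pi>)
  define T where "T v = T0 (\<pi> v) + (v - \<pi> v) - Q 0 (v - \<pi> v)" for v
  have lin: "linear T"
    by (rule linearI) (simp_all add: T_def T0.add \<pi>.add Q.add Q.diff T0.scaleR \<pi>.scaleR Q.scaleR algebra_simps)
  have \<pi>V0: "\<pi> v \<in> ?V0" for v using \<pi>(1) by auto
  have QT: "Q 0 (T v) = T0 (\<pi> v)" for v
    using fix_Q[OF T0(3)[OF \<pi>V0[of v]]] by (simp add: T_def Q.add Q.diff Q_idem)
  have T_V0: "T v = T0 v" if "v \<in> ?V0" for v using \<pi>(3)[OF that] by (simp add: T_def Q.zero)
  have inj: "inj_on T V"
  proof -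
    have "v = 0" if v: "v \<in> V" "T v = 0" for v
    proof -
      have "T0 (\<pi> v) = T0 0" using QT[of v] v(2) by (simp add: Q.zero T0.zero)
      then have pv: "\<pi> v = 0" by (rule inj_onD[OF T0(2) _ \<pi>V0 subspace_0[OF V0]])
      then have "v = Q 0 v" using v(2) by (simp add: T_def T0.zero)
      then have "v \<in> ?V0" using v(1) by (metis IntI rangeI)
      then show "v = 0" using \<pi>(3) pv by metis
    qed
    then show ?thesis using linear_injective_on_subspace_0[OF lin V] by simp
  qed
  let ?U = "{v \<in> V. \<pi> v = 0}"
  have U: "subspace ?U"
    using subspace_inter[OF V linear_subspace_kernel[OF \<pi>(2)]] by (simp add: Int_def)
  have linR: "linear (\<lambda>u. u - Q 0 u)" using linear_compose_sub[OF linear_id linear_Q[of 0]] by (simp add: id_def)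
  \<comment> \<open>A vector of the complement that equals its stable component lies in
    \<open>?V0\<close> and is therefore 0. In finite dimension this gives a lower bound with a
    constant \<open>c\<close>, which depends on \<open>V\<close>.\<close>
  have "\<forall>u\<in>?U. u - Q 0 u = 0 \<longrightarrow> u = 0"
  proof (intro ballI impI)
    fix u assume u: "u \<in> ?U" "u - Q 0 u = 0"
    then have "u = Q 0 u" by simp
    then have "u \<in> ?V0" using u(1) by (metis (no_types, lifting) IntI mem_Collect_eq rangeI)
    then show "u = 0" using \<pi>(3) u(1) by force
  qed
  then obtain c where c: "c > 0" "\<And>u. u \<in> ?U \<Longrightarrow> c * norm u \<le> norm (u - Q 0 u)"
    using injective_imp_isometric[OF closed_subspace[OF U] U, of "\<lambda>u. u - Q 0 u"]
      linR[unfolded linear_conv_bounded_linear] by blast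
  \<comment> \<open>First summand: the error of \<open>T0\<close>, with \<open>K\<close> bounding
    \<open>Q n\<close>. Second: the dropped component \<open>Q 0 u\<close>, where
    \<open>K * q ^ n\<close> is \<open>ratio\<close> from time 0, \<open>K / c\<close> compares
    \<open>Q 0 u\<close> with \<open>u - Q 0 u\<close> at time 0, and \<open>1 + K\<close> bounds
    the complementary projector at time \<open>n\<close>.\<close>
  define e' where "e' n = \<bar>e n\<bar> * K + (K / c) * q ^ n * (K * (1 + K))" for n
  have "e' \<longlonglongrightarrow> \<bar>0\<bar> * K + (K / c) * 0 * (K * (1 + K))"
    unfolding e'_def by (intro tendsto_intros e(1) LIMSEQ_realpow_zero q)
  then have "e' \<longlonglongrightarrow> 0" by simp
  moreover have "norm (F n (T v - v)) \<le> e' n * norm (F n (T v))" if v: "v \<in> V" for n v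
  proof -
    let ?u = "v - \<pi> v" let ?x = "?u - Q 0 ?u" let ?y = "Q 0 ?u"
    have uU: "?u \<in> ?U" using v \<pi>V0[of v] subspace_diff[OF V] \<pi>(3)[OF \<pi>V0[of v]] by (simp add: \<pi>.diff)
    have split: "T v - v = (T0 (\<pi> v) - \<pi> v) - ?y" by (simp add: T_def)
    have Tv: "T v = T0 (\<pi> v) + ?x" by (simp add: T_def)
    have "norm (F n (T0 (\<pi> v) - \<pi> v)) \<le> e n * norm (F n (T0 (\<pi> v)))" by (rule e(2)[OF \<pi>V0])
    also have "\<dots> \<le> \<bar>e n\<bar> * norm (Q n (F n (T v)))"
      unfolding Q_F QT by (intro mult_right_mono) auto
    also have "\<dots> \<le> \<bar>e n\<bar> * (K * norm (F n (T v)))" by (intro mult_left_mono Q_bound) auto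
    finally have 1: "norm (F n (T0 (\<pi> v) - \<pi> v)) \<le> \<bar>e n\<bar> * K * norm (F n (T v))" by (simp add: mult.assoc)
    have x: "F n ?x = F n (T v) - Q n (F n (T v))" unfolding Q_F QT by (simp add: Tv F.diff F.add)
    have nx: "norm (F n ?x) \<le> (1 + K) * norm (F n (T v))"
      unfolding x using norm_triangle_ineq4[of "F n (T v)" "Q n (F n (T v))"] Q_bound[of n "F n (T v)"]
      by (simp add: algebra_simps)
    have "norm (F n ?y) * norm ?x \<le> K * q ^ n * (norm (F n ?x) * norm ?y)"
      using ratio[of ?x ?y 0 n] by (simp add: Q.diff Q_idem F_0)
    also have "\<dots> \<le> K * q ^ n * (norm (F n ?x) * (K * (norm ?x / c)))"
    proof (intro mult_left_mono)
      have "norm ?u \<le> norm ?x / c" using c(2)[OF uU] c(1) by (simp add: field_simps)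
      then have "K * norm ?u \<le> K * (norm ?x / c)" using K by (intro mult_left_mono) auto
      then show "norm ?y \<le> K * (norm ?x / c)" using Q_bound[of 0 ?u] by linarith
    qed (use K q in auto)
    also have "\<dots> = (K / c) * q ^ n * (K * norm (F n ?x)) * norm ?x" by simp
    also have "\<dots> \<le> (K / c) * q ^ n * (K * ((1 + K) * norm (F n (T v)))) * norm ?x"
      by (intro mult_right_mono mult_left_mono nx) (use K q c in auto)
    finally have le: "norm (F n ?y) * norm ?x \<le> ((K / c) * q ^ n * (K * (1 + K)) * norm (F n (T v))) * norm ?x"
      by (simp only: mult.assoc)
    have 2: "norm (F n ?y) \<le> (K / c) * q ^ n * (K * (1 + K)) * norm (F n (T v))"
    proof (cases "?x = 0")
      case True
      then have "?u = 0" using c(2)[OF uU] c(1) by (simp add: mult_le_0_iff)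
      then show ?thesis using K q c by (simp add: F.zero Q.zero)
    next
      case False
      then have "0 < norm ?x" by simp
      then show ?thesis using le by (rule mult_right_le_imp_le[rotated])
    qed
    show ?thesis unfolding split F.diff[of n "T0 (\<pi> v) - \<pi> v"] e'_def distrib_right
      by (rule order_trans[OF norm_triangle_ineq4 add_mono[OF 1 2]])
  qed
  moreover have "\<exists>w\<in>?V0. Q 0 (T v) = T w \<and> T v = T w + (v - w) - Q 0 (v - w)" for v
    by (rule bexI[OF _ \<pi>V0[of v]]) (use QT[of v] T_V0[OF \<pi>V0[of v]] in \<open>simp add: T_def\<close>)
  ultimately show thesis using that[OF lin inj T_V0] by blast
qed

text \<open>A trajectory follows its \<open>range (Q n)\<close> component up to some time and its complementary component
  from then on; the length \<open>N\<close> of the transition does not depend on the initial vector.\<close>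

lemma transition_time:
  assumes "\<eta> > 0"
  obtains N where "\<And>x y. \<lbrakk>Q 0 x = 0; Q 0 y = y; x \<noteq> 0\<rbrakk> \<Longrightarrow> \<exists>\<tau>.
      (\<forall>j\<ge>\<tau>. norm (F j y) \<le> \<eta> * norm (F j x)) \<and>
      (\<forall>j. j + N < \<tau> \<longrightarrow> norm (F j x) \<le> \<eta> * norm (F j y))"
proof -
  have pos: "norm (F n x) > 0" if "x \<noteq> 0" for n x
    using inj_F[of n] linear_0[OF linear_F[of n]] that unfolding inj_def by (metis zero_less_norm_iff)
  have "(\<lambda>n. K\<^sup>2 * q ^ n) \<longlonglongrightarrow> K\<^sup>2 * 0"
    by (intro tendsto_intros LIMSEQ_realpow_zero q)
  then have "\<forall>\<^sub>F n in sequentially. K\<^sup>2 * q ^ n < \<eta>\<^sup>2"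
    using assms by (intro order_tendstoD) auto
  then obtain N where "K\<^sup>2 * q ^ N < \<eta>\<^sup>2" by (auto simp: eventually_sequentially)
  \<comment> \<open>One \<open>K\<close> comes from \<open>ratio\<close>, the other from
    \<open>R\<close> below; one \<open>\<eta>\<close> belongs to the failure of \<open>R\<close>
    just before \<open>\<tau>\<close>, the other is the factor wanted at time
    \<open>j\<close>.\<close>
  then have N: "K * q ^ n * K \<le> \<eta> * \<eta>" if "n \<ge> N" for n
  proof -
    have "K\<^sup>2 * q ^ n \<le> K\<^sup>2 * q ^ N"
      using power_decreasing[OF that, of q] q by (intro mult_left_mono) auto
    then show ?thesis using \<open>K\<^sup>2 * q ^ N < \<eta>\<^sup>2\<close> by (simp add: power2_eq_square algebra_simps)
  qed
  show thesis
  proof (rule that)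
    fix x y assume x: "Q 0 x = 0" "x \<noteq> 0" and y: "Q 0 y = y"
    \<comment> \<open>The spare factor \<open>K\<close> pays for \<open>ratio\<close>: once
      \<open>R\<close> holds, the inequality without \<open>K\<close> holds at all later
      times.\<close>
    define R where "R t \<longleftrightarrow> K * norm (F t y) \<le> \<eta> * norm (F t x)" for t
    \<comment> \<open>\<open>R\<close> holds at some time depending on \<open>x\<close> and
      \<open>y\<close>; this only secures that a first such time exists.\<close>
    have "(\<lambda>n. K * (K * q ^ n * norm y)) \<longlonglongrightarrow> K * (K * 0 * norm y)"
      by (intro tendsto_intros LIMSEQ_realpow_zero q)
    moreover have "0 < \<eta> * norm x" using assms x by simp
    ultimately have "\<forall>\<^sub>F n in sequentially. K * (K * q ^ n * norm y) < \<eta> * norm x"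
      by (intro order_tendstoD) auto
    then obtain n where n: "K * (K * q ^ n * norm y) < \<eta> * norm x" by (auto simp: eventually_sequentially)
    have "K * norm (F n y) * norm x \<le> K * (K * q ^ n * norm y) * norm (F n x)"
      using mult_left_mono[OF ratio[OF x(1) y, of 0 n], of K] K by (simp add: F_0 algebra_simps)
    also have "\<dots> \<le> \<eta> * norm x * norm (F n x)" using n by (intro mult_right_mono) auto
    finally have "R n" using x(2) by (simp add: R_def algebra_simps)
    define \<tau> where "\<tau> = (LEAST t. R t)"
    have R\<tau>: "R \<tau>" unfolding \<tau>_def by (rule LeastI[of R, OF \<open>R n\<close>])
    have less: "\<not> R t" if "t < \<tau>" for t using not_less_Least that unfolding \<tau>_def by blast
    have "norm (F j y) \<le> \<eta> * norm (F j x)" if "j \<ge> \<tau>" for j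
    proof -
      have "norm (F j y) * norm (F \<tau> x) \<le> K * q ^ (j - \<tau>) * (norm (F j x) * norm (F \<tau> y))"
        by (rule ratio[OF x(1) y that])
      also have "\<dots> \<le> K * 1 * (norm (F j x) * norm (F \<tau> y))"
        by (intro mult_right_mono mult_left_mono power_le_one) (use K q in auto)
      also have "\<dots> = norm (F j x) * (K * norm (F \<tau> y))" by simp
      also have "\<dots> \<le> norm (F j x) * (\<eta> * norm (F \<tau> x))"
        using R\<tau> by (intro mult_left_mono) (auto simp: R_def)
      finally have "norm (F j y) * norm (F \<tau> x) \<le> (\<eta> * norm (F j x)) * norm (F \<tau> x)"
        by (simp add: mult.left_commute mult.commute)
      then show ?thesis using pos[OF x(2), of \<tau>] mult_le_cancel_right_pos by blast
    qed
    moreover have "norm (F j x) \<le> \<eta> * norm (F j y)" if j: "j + N < \<tau>" for j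
    proof -
      \<comment> \<open>The last time before \<open>\<tau>\<close>, where \<open>R\<close> fails.
        Carried back from \<open>t\<close> to \<open>j\<close> by \<open>ratio\<close>, this failure
        gains \<open>q ^ (t - j)\<close>, and \<open>j + N < \<tau>\<close> gives
        \<open>N \<le> t - j\<close>.\<close>
      define t where "t = \<tau> - 1"
      have t: "t < \<tau>" "j \<le> t" "N \<le> t - j" using j by (auto simp: t_def)
      have nR: "\<eta> * norm (F t x) < K * norm (F t y)" using less[OF t(1)] by (simp add: R_def)
      moreover have "0 \<le> \<eta> * norm (F t x)" using assms by simp
      ultimately have "0 < K * norm (F t y)" by linarith
      then have y0: "norm (F t y) > 0" using K by (simp add: zero_less_mult_iff)
      have "\<eta> * (norm (F t y) * norm (F j x)) \<le> \<eta> * (K * q ^ (t - j) * (norm (F t x) * norm (F j y)))"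
        by (intro mult_left_mono ratio[OF x(1) y t(2)]) (use assms in simp)
      also have "\<dots> = K * q ^ (t - j) * norm (F j y) * (\<eta> * norm (F t x))" by simp
      also have "\<dots> \<le> K * q ^ (t - j) * norm (F j y) * (K * norm (F t y))"
        using nR by (intro mult_left_mono) (use K q in auto)
      also have "\<dots> = (K * q ^ (t - j) * K) * (norm (F j y) * norm (F t y))" by simp
      also have "\<dots> \<le> (\<eta> * \<eta>) * (norm (F j y) * norm (F t y))"
        by (intro mult_right_mono N t(3)) auto
      finally have "(\<eta> * norm (F t y)) * norm (F j x) \<le> (\<eta> * norm (F t y)) * (\<eta> * norm (F j y))"
        by (simp add: algebra_simps)
      then show ?thesis using y0 assms by (simp add: mult_le_cancel_left_pos)
    qed
    ultimately show "\<exists>\<tau>. (\<forall>j\<ge>\<tau>. norm (F j y) \<le> \<eta> * norm (F j x)) \<and>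
        (\<forall>j. j + N < \<tau> \<longrightarrow> norm (F j x) \<le> \<eta> * norm (F j y))" by blast
  qed
qed

end

section \<open>Angle sums along a flow\<close>

text \<open>\<open>C\<close> may depend on \<open>e\<close>: divided by \<open>n\<close> it
  disappears, so the limits differ by at most every positive \<open>e\<close>.\<close>

lemma lim_eq_of_sublinear_diff:
  fixes f g :: "nat \<Rightarrow> real"
  assumes f: "convergent (\<lambda>n. f n / real n)" and g: "convergent (\<lambda>n. g n / real n)"
    and d: "\<And>e. e > 0 \<Longrightarrow> \<exists>C. \<forall>n. \<bar>f n - g n\<bar> \<le> real n * e + C"
  shows "lim (\<lambda>n. f n / real n) = lim (\<lambda>n. g n / real n)"
proof -
  obtain a b where a: "(\<lambda>n. f n / real n) \<longlonglongrightarrow> a" and b: "(\<lambda>n. g n / real n) \<longlonglongrightarrow> b"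
    using f g by (auto simp: convergent_def)
  have "\<bar>a - b\<bar> \<le> e" if e: "e > 0" for e
  proof -
    obtain C where C: "\<And>n. \<bar>f n - g n\<bar> \<le> real n * e + C" using d[OF e] by auto
    have "(\<lambda>n. e + C / real n) \<longlonglongrightarrow> e + 0" by (intro tendsto_intros lim_const_over_n)
    moreover have "(\<lambda>n. \<bar>f n / real n - g n / real n\<bar>) \<longlonglongrightarrow> \<bar>a - b\<bar>" by (intro tendsto_intros a b)
    moreover have "\<bar>f n / real n - g n / real n\<bar> \<le> e + C / real n" if "n \<ge> 1" for n
    proof -
      have "\<bar>f n / real n - g n / real n\<bar> = \<bar>f n - g n\<bar> / real n"
        by (simp add: diff_divide_distrib[symmetric])
      also have "\<dots> \<le> (real n * e + C) / real n" by (intro divide_right_mono C) auto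
      finally show ?thesis using that by (simp add: add_divide_distrib)
    qed
    ultimately have "\<bar>a - b\<bar> \<le> e + 0" by (intro LIMSEQ_le) auto
    then show ?thesis by simp
  qed
  then have "\<bar>a - b\<bar> \<le> 0" by (rule field_le_epsilon) simp
  then have "a = b" by simp
  then show ?thesis unfolding limI[OF a] limI[OF b] .
qed

context linear_flow
begin

lemma subspace_F: "subspace V \<Longrightarrow> subspace (F n ` V)"
  by (rule linear_subspace_image[OF linear_F])

lemma dim_F: "subspace V \<Longrightarrow> dim (F n ` V) = dim V"
  using dim_image_eq[OF linear_F, of n V] inj_F inj_on_subset by (metis subset_UNIV)

lemma F_eq_0: "F n x = 0 \<longleftrightarrow> x = 0"
  using inj_F[of n] linear_0[OF linear_F[of n]] unfolding inj_def by metis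

definition step_angle :: "nat \<Rightarrow> (real ^ 'd) set \<Rightarrow> real" where
  "step_angle j V = principal_angle (F j ` V) (F (Suc j) ` V)"

text \<open>Half-open windows, so that adjacent sums concatenate. Step \<open>j\<close> compares
  times \<open>j\<close> and \<open>Suc j\<close>; hence the window from \<open>k\<close> to
  \<open>k + n\<close> corresponds to \<open>angle_sum\<close> from \<open>k + 1\<close> to
  \<open>k + n\<close>.\<close>

definition angle_over :: "nat \<Rightarrow> nat \<Rightarrow> (real ^ 'd) set \<Rightarrow> real" where
  "angle_over k m V = (\<Sum>j=k..<m. step_angle j V)"

lemma step_angle_bounds:
  assumes "subspace V" "1 \<le> dim V"
  shows "0 \<le> step_angle j V" "step_angle j V \<le> pi / 2"
  unfolding step_angle_def using assms
  by (intro principal_angle_bounds; simp add: subspace_F dim_F)+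

lemma angle_over_bounds:
  assumes "subspace V" "1 \<le> dim V"
  shows "0 \<le> angle_over k m V" "angle_over k m V \<le> real (m - k) * (pi / 2)"
  unfolding angle_over_def
  using sum_bounded_above[of "{k..<m}" "\<lambda>j. step_angle j V" "pi / 2"] step_angle_bounds[OF assms]
  by (auto intro: sum_nonneg)

lemma angle_over_concat:
  "\<lbrakk>k \<le> m; m \<le> n\<rbrakk> \<Longrightarrow> angle_over k n V = angle_over k m V + angle_over m n V"
  unfolding angle_over_def by (simp add: sum.atLeastLessThan_concat)

text \<open>Every step angle is at most \<open>pi / 2\<close>, so the suprema are over bounded sets
  and behave as least upper bounds. The family of all lines serves the inner values, a singleton
  family the outer ones.\<close>

lemma sup_angle_over:
  assumes ne: "\<V> \<noteq> {}" and V: "\<And>V. V \<in> \<V> \<Longrightarrow> subspace V \<and> 1 \<le> dim V"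
  shows "\<And>c. (\<And>V k. V \<in> \<V> \<Longrightarrow> angle_over k (k + n) V \<le> c) \<Longrightarrow> (SUP V\<in>\<V>. SUP k. angle_over k (k + n) V) \<le> c"
    and "\<And>V k. V \<in> \<V> \<Longrightarrow> angle_over k (k + n) V \<le> (SUP V\<in>\<V>. SUP k. angle_over k (k + n) V)"
proof -
  show "(SUP V\<in>\<V>. SUP k. angle_over k (k + n) V) \<le> c"
    if "\<And>V k. V \<in> \<V> \<Longrightarrow> angle_over k (k + n) V \<le> c" for c
    by (intro cSUP_least ne that) auto
  have bnd: "angle_over k (k + n) V \<le> real n * (pi / 2)" if "V \<in> \<V>" for V k
    using angle_over_bounds(2)[of V k "k + n"] V[OF that] by simp
  have "bdd_above (range (\<lambda>k. angle_over k (k + n) V))" if "V \<in> \<V>" for V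
    using bnd[OF that] by (rule bdd_aboveI2)
  moreover have "(SUP k. angle_over k (k + n) V) \<le> real n * (pi / 2)" if "V \<in> \<V>" for V
    using bnd[OF that] by (intro cSUP_least) auto
  then have "bdd_above ((\<lambda>V. SUP k. angle_over k (k + n) V) ` \<V>)" by (rule bdd_aboveI2)
  ultimately show "angle_over k (k + n) V \<le> (SUP V\<in>\<V>. SUP k. angle_over k (k + n) V)" if "V \<in> \<V>" for V k
    using that by (intro order_trans[OF cSUP_upper[of k UNIV "\<lambda>k. angle_over k (k + n) V"]]
        cSUP_upper[of V \<V> "\<lambda>V. SUP k. angle_over k (k + n) V"]) auto
qed

lemma inf_angle_over:
  assumes V: "subspace V" "1 \<le> dim V"
  shows "\<And>c. (\<And>k. c \<le> angle_over k (k + n) V) \<Longrightarrow> c \<le> (INF k. angle_over k (k + n) V)"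
    and "\<And>k. (INF k. angle_over k (k + n) V) \<le> angle_over k (k + n) V"
proof -
  show "c \<le> (INF k. angle_over k (k + n) V)" if "\<And>k. c \<le> angle_over k (k + n) V" for c
    by (intro cINF_greatest that) auto
  have "bdd_below (range (\<lambda>k. angle_over k (k + n) V))"
    using angle_over_bounds(1)[OF V] by (intro bdd_belowI2) auto
  then show "(INF k. angle_over k (k + n) V) \<le> angle_over k (k + n) V" for k
    by (rule cINF_lower) auto
qed

text \<open>Cutting a window of length \<open>m + n\<close> after \<open>m\<close> steps leaves two
  windows that the supremum over all starting times admits; this is subadditivity.\<close>

lemma convergent_sup_angle_over:
  assumes ne: "\<V> \<noteq> {}" and V: "\<And>V. V \<in> \<V> \<Longrightarrow> subspace V \<and> 1 \<le> dim V"
  shows "convergent (\<lambda>n. (SUP V\<in>\<V>. SUP k. angle_over k (k + n) V) / real n)"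
proof (rule subadditive_convergent[where C = 0])
  note S = sup_angle_over[OF ne V]
  fix m n
  show "(SUP V\<in>\<V>. SUP k. angle_over k (k + (m + n)) V)
    \<le> (SUP V\<in>\<V>. SUP k. angle_over k (k + m) V) + (SUP V\<in>\<V>. SUP k. angle_over k (k + n) V)"
  proof (rule S(1))
    fix V k assume "V \<in> \<V>"
    then show "angle_over k (k + (m + n)) V
      \<le> (SUP V\<in>\<V>. SUP k. angle_over k (k + m) V) + (SUP V\<in>\<V>. SUP k. angle_over k (k + n) V)"
      using angle_over_concat[of k "k + m" "k + (m + n)" V] S(2)[of V k m] S(2)[of V "k + m" n]
      by (simp add: add.assoc)
  qed
  obtain V where "V \<in> \<V>" using ne by auto
  then show "- 0 * real n \<le> (SUP V\<in>\<V>. SUP k. angle_over k (k + n) V)"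
    using S(2)[of V 0 n] angle_over_bounds(1)[of V 0 "0 + n"] V by fastforce
qed

text \<open>The infimum is superadditive, so Fekete's lemma is applied to its negative, bounded
  below by \<open>pi / 2\<close> per step.\<close>

lemma convergent_inf_angle_over:
  assumes V: "subspace V" "1 \<le> dim V"
  shows "convergent (\<lambda>n. (INF k. angle_over k (k + n) V) / real n)"
proof -
  note S = inf_angle_over[OF V]
  have "convergent (\<lambda>n. - (INF k. angle_over k (k + n) V) / real n)"
  proof (rule subadditive_convergent[where C = "pi / 2"])
    fix m n
    have "(INF k. angle_over k (k + m) V) + (INF k. angle_over k (k + n) V)
        \<le> (INF k. angle_over k (k + (m + n)) V)"
    proof (rule S(1))
      fix k
      show "(INF k. angle_over k (k + m) V) + (INF k. angle_over k (k + n) V) \<le> angle_over k (k + (m + n)) V"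
        using angle_over_concat[of k "k + m" "k + (m + n)" V] S(2)[of m k] S(2)[of n "k + m"]
        by (simp add: add.assoc)
    qed
    then show "- (INF k. angle_over k (k + (m + n)) V)
      \<le> - (INF k. angle_over k (k + m) V) + - (INF k. angle_over k (k + n) V)" by simp
    show "- (pi / 2) * real n \<le> - (INF k. angle_over k (k + n) V)"
      using S(2)[of n 0] angle_over_bounds(2)[OF V, of 0 "0 + n"] by (simp add: mult.commute)
  qed
  then have "convergent (\<lambda>n. - (- (INF k. angle_over k (k + n) V) / real n))" by (rule convergent_minus_iff[THEN iffD1])
  then show ?thesis by simp
qed

text \<open>Closeness fails only before an absolute time \<open>N\<close>, wherever the window
  begins. Thus \<open>C\<close> is independent of \<open>k\<close>, and the bound survives both the
  supremum and the infimum over \<open>k\<close>.\<close>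

lemma angle_over_diff_of_close:
  assumes V: "subspace V" "1 \<le> dim V" and V': "subspace V'" "1 \<le> dim V'"
    and d: "d \<longlonglongrightarrow> 0" "\<And>n. sphere_close (d n) (F n ` V) (F n ` V')" and e: "e > 0"
  shows "\<exists>C. \<forall>k n. \<bar>angle_over k (k + n) V - angle_over k (k + n) V'\<bar> \<le> real n * e + C"
proof -
  obtain \<delta> where \<delta>: "\<delta> > 0" and per: "\<And>V V' W W' :: (real ^ 'd) set.
    subspace V \<Longrightarrow> subspace V' \<Longrightarrow> subspace W \<Longrightarrow> subspace W' \<Longrightarrow>
    1 \<le> dim V \<Longrightarrow> 1 \<le> dim V' \<Longrightarrow> 1 \<le> dim W \<Longrightarrow> 1 \<le> dim W' \<Longrightarrow>
    sphere_close \<delta> V V' \<Longrightarrow> sphere_close \<delta> W W' \<Longrightarrow>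
    \<bar>principal_angle V W - principal_angle V' W'\<bar> \<le> e"
    using principal_angle_perturb[OF e] by blast
  obtain N where N: "\<And>n. n \<ge> N \<Longrightarrow> d n < \<delta>"
    using order_tendstoD(2)[OF d(1) \<delta>] by (auto simp: eventually_sequentially)
  have cl: "sphere_close \<delta> (F n ` V) (F n ` V')" if "n \<ge> N" for n
    using sphere_close_mono[OF d(2)] N[OF that] by (metis less_imp_le)
  have step: "\<bar>step_angle j V - step_angle j V'\<bar> \<le> e + (if j < N then pi else 0)" for j
  proof (cases "j < N")
    case True
    then show ?thesis using step_angle_bounds[OF V, of j] step_angle_bounds[OF V', of j] e by simp
  next
    case False
    then show ?thesis unfolding step_angle_def
      using V V' cl by (auto intro!: per simp: subspace_F dim_F)
  qed
  have "\<bar>angle_over k (k + n) V - angle_over k (k + n) V'\<bar> \<le> real n * e + real N * pi" for k n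
  proof -
    have "\<bar>angle_over k (k + n) V - angle_over k (k + n) V'\<bar>
        \<le> (\<Sum>j=k..<k + n. \<bar>step_angle j V - step_angle j V'\<bar>)"
      unfolding angle_over_def sum_subtractf[symmetric] by (rule sum_abs)
    also have "\<dots> \<le> (\<Sum>j=k..<k + n. e + (if j < N then pi else 0))" by (intro sum_mono step)
    also have "\<dots> = real n * e + (\<Sum>j\<in>{k..<k + n} \<inter> {..<N}. pi)"
      unfolding sum.distrib by (simp add: sum.inter_restrict del: sum_constant)
        (simp add: mult.commute)
    also have "(\<Sum>j\<in>{k..<k + n} \<inter> {..<N}. pi) \<le> (\<Sum>j\<in>{..<N}. pi)"
      by (intro sum_mono2) auto
    finally show ?thesis by simp
  qed
  then show ?thesis by blast
qed

lemma outer_lim_eq_of_close: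
  assumes V: "subspace V" "1 \<le> dim V" and V': "subspace V'" "1 \<le> dim V'"
    and d: "\<And>e. e > 0 \<Longrightarrow> \<exists>C. \<forall>k n. \<bar>angle_over k (k + n) V - angle_over k (k + n) V'\<bar> \<le> real n * e + C"
  shows "lim (\<lambda>n. (SUP k. angle_over k (k + n) V) / real n) = lim (\<lambda>n. (SUP k. angle_over k (k + n) V') / real n)"
    "lim (\<lambda>n. (INF k. angle_over k (k + n) V) / real n) = lim (\<lambda>n. (INF k. angle_over k (k + n) V') / real n)"
proof -
  let ?S = "\<lambda>n V. SUP k. angle_over k (k + n) V" and ?I = "\<lambda>n V. INF k. angle_over k (k + n) V"
  have S: "\<And>n c. (\<And>k. angle_over k (k + n) W \<le> c) \<Longrightarrow> ?S n W \<le> c" "\<And>n k. angle_over k (k + n) W \<le> ?S n W"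
    "convergent (\<lambda>n. ?S n W / real n)"
    if "subspace W" "1 \<le> dim W" for W
    using sup_angle_over[of "{W}"] convergent_sup_angle_over[of "{W}"] that by auto
  show "lim (\<lambda>n. ?S n V / real n) = lim (\<lambda>n. ?S n V' / real n)"
  proof (rule lim_eq_of_sublinear_diff[OF S(3)[OF V] S(3)[OF V']])
    fix e :: real assume "e > 0"
    then obtain C where C: "\<And>k n. \<bar>angle_over k (k + n) V - angle_over k (k + n) V'\<bar> \<le> real n * e + C"
      using d by blast
    have le1: "?S n V \<le> ?S n V' + (real n * e + C)" for n
    proof (rule S(1)[OF V])
      fix k show "angle_over k (k + n) V \<le> ?S n V' + (real n * e + C)"
        using C[of k n] S(2)[OF V', of k n] by linarith
    qed
    have le2: "?S n V' \<le> ?S n V + (real n * e + C)" for n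
    proof (rule S(1)[OF V'])
      fix k show "angle_over k (k + n) V' \<le> ?S n V + (real n * e + C)"
        using C[of k n] S(2)[OF V, of k n] by linarith
    qed
    have "\<bar>?S n V - ?S n V'\<bar> \<le> real n * e + C" for n using le1[of n] le2[of n] by linarith
    then show "\<exists>C. \<forall>n. \<bar>?S n V - ?S n V'\<bar> \<le> real n * e + C" by blast
  qed
  show "lim (\<lambda>n. ?I n V / real n) = lim (\<lambda>n. ?I n V' / real n)"
  proof (rule lim_eq_of_sublinear_diff[OF convergent_inf_angle_over[OF V] convergent_inf_angle_over[OF V']])
    fix e :: real assume "e > 0"
    then obtain C where C: "\<And>k n. \<bar>angle_over k (k + n) V - angle_over k (k + n) V'\<bar> \<le> real n * e + C"
      using d by blast
    have le1: "?I n V - (real n * e + C) \<le> ?I n V'" for n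
    proof (rule inf_angle_over(1)[OF V'])
      fix k show "?I n V - (real n * e + C) \<le> angle_over k (k + n) V'"
        using C[of k n] inf_angle_over(2)[OF V, of n k] by linarith
    qed
    have le2: "?I n V' - (real n * e + C) \<le> ?I n V" for n
    proof (rule inf_angle_over(1)[OF V])
      fix k show "?I n V' - (real n * e + C) \<le> angle_over k (k + n) V"
        using C[of k n] inf_angle_over(2)[OF V', of n k] by linarith
    qed
    have "\<bar>?I n V - ?I n V'\<bar> \<le> real n * e + C" for n using le1[of n] le2[of n] by linarith
    then show "\<exists>C. \<forall>n. \<bar>?I n V - ?I n V'\<bar> \<le> real n * e + C" by blast
  qed
qed

lemma sphere_close_image:
  assumes V: "subspace V" and T: "linear T" "inj_on T V"
    and e: "\<And>v. v \<in> V \<Longrightarrow> norm (F n (T v - v)) \<le> \<eta> * norm (F n (T v))"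
  shows "sphere_close (2 * \<eta>) (F n ` V) (F n ` T ` V)"
proof (rule sphere_closeI)
  show "subspace (F n ` V)" "subspace (F n ` T ` V)"
    by (intro subspace_F V linear_subspace_image T)+
  have T0: "T v = 0 \<longleftrightarrow> v = 0" if "v \<in> V" for v
    using linear_injective_on_subspace_0[OF T(1) V] T(2) that linear_0[OF T(1)] by auto
  have est: "norm (F n v - F n (T v)) \<le> \<eta> * norm (F n (T v))" if "v \<in> V" for v
    using e[OF that] by (simp add: linear_diff[OF linear_F] norm_minus_commute)
  show "\<exists>v'\<in>F n ` T ` V. v' \<noteq> 0 \<and> norm (v - v') \<le> \<eta> * norm v'" if v: "v \<in> F n ` V" "v \<noteq> 0" for v
  proof -
    obtain w where "w \<in> V" "v = F n w" using v(1) by auto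
    then show ?thesis using v(2) est[of w] T0[of w] by (intro bexI[of _ "F n (T w)"]) (auto simp: F_eq_0)
  qed
  show "\<exists>v\<in>F n ` V. v \<noteq> 0 \<and> norm (v - v') \<le> \<eta> * norm v'" if v: "v' \<in> F n ` T ` V" "v' \<noteq> 0" for v'
  proof -
    obtain w where "w \<in> V" "v' = F n (T w)" using v(1) by auto
    then show ?thesis using v(2) est[of w] T0[of w] by (intro bexI[of _ "F n w"]) (auto simp: F_eq_0)
  qed
qed

lemma sphere_close_lines:
  assumes "v \<noteq> 0" "x \<noteq> 0" and e: "norm (F n (v - x)) \<le> \<eta> * norm (F n x)"
  shows "sphere_close (2 * \<eta>) (F n ` span {v}) (F n ` span {x})"
proof (rule sphere_closeI)
  show "subspace (F n ` span {v})" "subspace (F n ` span {x})"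
    by (intro subspace_F subspace_span)+
  have est: "norm (F n (c *\<^sub>R v) - F n (c *\<^sub>R x)) \<le> \<eta> * norm (F n (c *\<^sub>R x))" for c
  proof -
    have "norm (F n (c *\<^sub>R v) - F n (c *\<^sub>R x)) = \<bar>c\<bar> * norm (F n (v - x))"
      by (simp add: linear_diff[OF linear_F, symmetric] linear_scale[OF linear_F] scaleR_diff_right[symmetric])
    also have "\<dots> \<le> \<bar>c\<bar> * (\<eta> * norm (F n x))" by (intro mult_left_mono e) auto
    finally show ?thesis by (simp add: linear_scale[OF linear_F] mult.left_commute)
  qed
  show "\<exists>w'\<in>F n ` span {x}. w' \<noteq> 0 \<and> norm (w - w') \<le> \<eta> * norm w'" if w: "w \<in> F n ` span {v}" "w \<noteq> 0" for w
  proof -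
    obtain c where c: "w = F n (c *\<^sub>R v)" using w(1) by (auto simp: span_singleton)
    then show ?thesis using w(2) assms(2) est[of c]
      by (intro bexI[of _ "F n (c *\<^sub>R x)"]) (auto simp: F_eq_0 span_singleton)
  qed
  show "\<exists>w\<in>F n ` span {v}. w \<noteq> 0 \<and> norm (w - w') \<le> \<eta> * norm w'" if w: "w' \<in> F n ` span {x}" "w' \<noteq> 0" for w'
  proof -
    obtain c where c: "w' = F n (c *\<^sub>R x)" using w(1) by (auto simp: span_singleton)
    then show ?thesis using w(2) assms(1) est[of c]
      by (intro bexI[of _ "F n (c *\<^sub>R v)"]) (auto simp: F_eq_0 span_singleton)
  qed
qed

text \<open>For \<open>\<theta> \<ge> 0\<close> and sets containing a nonzero vector this says
  \<open>growth_rate S \<le> \<theta>\<close>. The form with arbitrary windows and one constant for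
  all \<open>v\<close> allows a window to be cut at a time that depends on \<open>v\<close>.\<close>

definition angle_growth :: "(real ^ 'd) set \<Rightarrow> real \<Rightarrow> bool" where
  "angle_growth S \<theta> \<longleftrightarrow> (\<forall>e>0. \<exists>C\<ge>0. \<forall>v\<in>S. v \<noteq> 0 \<longrightarrow>
     (\<forall>k m. k \<le> m \<longrightarrow> angle_over k m (span {v}) \<le> real (m - k) * (\<theta> + e) + C))"

lemma line_dim: "v \<noteq> 0 \<Longrightarrow> subspace (span {v :: real ^ 'd}) \<and> 1 \<le> dim (span {v})"
  by (simp add: subspace_span)

lemma angle_over_le_of_step_le:
  assumes "k \<le> m" "\<And>j. k \<le> j \<Longrightarrow> j < m \<Longrightarrow> step_angle j V \<le> step_angle j W + e"
  shows "angle_over k m V \<le> angle_over k m W + real (m - k) * e"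
proof -
  have "angle_over k m V \<le> (\<Sum>j=k..<m. step_angle j W + e)"
    unfolding angle_over_def using assms by (intro sum_mono) auto
  then show ?thesis by (simp add: angle_over_def sum.distrib)
qed

end

lemma (in dominated_splitting) angle_growth_sum:
  assumes S1: "angle_growth S1 \<theta>" "\<And>x. x \<in> S1 \<Longrightarrow> Q 0 x = 0"
    and S2: "angle_growth S2 \<theta>" "\<And>y. y \<in> S2 \<Longrightarrow> Q 0 y = y"
    and S: "\<And>v. v \<in> S \<Longrightarrow> \<exists>x\<in>S1. \<exists>y\<in>S2. v = x + y" and \<theta>: "\<theta> \<ge> 0"
  shows "angle_growth S \<theta>"
  unfolding angle_growth_def
proof (intro allI impI)
  fix e :: real assume e: "e > 0"
  then have e2: "e / 2 > 0" by simp
  obtain C1 where C1: "C1 \<ge> 0" "\<And>v k m. v \<in> S1 \<Longrightarrow> v \<noteq> 0 \<Longrightarrow> k \<le> m \<Longrightarrow>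
      angle_over k m (span {v}) \<le> real (m - k) * (\<theta> + e / 2) + C1"
    using S1(1) e2 unfolding angle_growth_def by meson
  obtain C2 where C2: "C2 \<ge> 0" "\<And>v k m. v \<in> S2 \<Longrightarrow> v \<noteq> 0 \<Longrightarrow> k \<le> m \<Longrightarrow>
      angle_over k m (span {v}) \<le> real (m - k) * (\<theta> + e / 2) + C2"
    using S2(1) e2 unfolding angle_growth_def by meson
  obtain \<delta> where \<delta>: "\<delta> > 0" and per: "\<And>V V' W W' :: (real ^ 'd) set.
    subspace V \<Longrightarrow> subspace V' \<Longrightarrow> subspace W \<Longrightarrow> subspace W' \<Longrightarrow>
    1 \<le> dim V \<Longrightarrow> 1 \<le> dim V' \<Longrightarrow> 1 \<le> dim W \<Longrightarrow> 1 \<le> dim W' \<Longrightarrow>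
    sphere_close \<delta> V V' \<Longrightarrow> sphere_close \<delta> W W' \<Longrightarrow>
    \<bar>principal_angle V W - principal_angle V' W'\<bar> \<le> e / 2"
    using principal_angle_perturb[OF e2] by blast
  obtain N where N: "\<And>x y. \<lbrakk>Q 0 x = 0; Q 0 y = y; x \<noteq> 0\<rbrakk> \<Longrightarrow> \<exists>\<tau>.
      (\<forall>j\<ge>\<tau>. norm (F j y) \<le> (\<delta> / 2) * norm (F j x)) \<and>
      (\<forall>j. j + N < \<tau> \<longrightarrow> norm (F j x) \<le> (\<delta> / 2) * norm (F j y))"
    using transition_time[of "\<delta> / 2"] \<delta> by auto
  have step: "step_angle j (span {v}) \<le> step_angle j (span {x}) + e / 2"
    if "v \<noteq> 0" "x \<noteq> 0" "norm (F j (v - x)) \<le> (\<delta> / 2) * norm (F j x)"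
      "norm (F (Suc j) (v - x)) \<le> (\<delta> / 2) * norm (F (Suc j) x)" for v x j
  proof -
    have "sphere_close \<delta> (F j ` span {v}) (F j ` span {x})"
      "sphere_close \<delta> (F (Suc j) ` span {v}) (F (Suc j) ` span {x})"
      using sphere_close_lines[OF that(1,2,3)] sphere_close_lines[OF that(1,2,4)] by simp_all
    then have "\<bar>step_angle j (span {v}) - step_angle j (span {x})\<bar> \<le> e / 2"
      unfolding step_angle_def using that(1,2)
      by (intro per) (auto simp: subspace_F dim_F subspace_span)
    then show ?thesis by linarith
  qed
  \<comment> \<open>The last summand covers at most \<open>N + 1\<close> steps of transition, each
    of angle at most \<open>pi / 2\<close>.\<close>
  define C where "C = C1 + C2 + (real N + 1) * (pi / 2)"
  have C0: "0 \<le> (real N + 1) * (pi / 2)" by simp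
  have "angle_over k m (span {v}) \<le> real (m - k) * (\<theta> + e) + C"
    if v: "v \<in> S" "v \<noteq> 0" and km: "k \<le> m" for v k m
  proof -
    obtain x y where x: "x \<in> S1" and y: "y \<in> S2" and vxy: "v = x + y" using S[OF v(1)] by blast
    have mono: "real (m - k) * (\<theta> + e / 2) \<le> real (m - k) * (\<theta> + e)"
      using e by (intro mult_left_mono) auto
    \<comment> \<open>The transition time requires \<open>x\<close> to be nonzero and the bound from
      \<open>S2\<close> requires \<open>y\<close> to be nonzero; if one component vanishes,
      \<open>v\<close> is the other one.\<close>
    consider "v = x" | "v = y" | "x \<noteq> 0" "y \<noteq> 0" using vxy by fastforce
    then show ?thesis
    proof cases
      case 1
      then have "angle_over k m (span {v}) \<le> real (m - k) * (\<theta> + e / 2) + C1"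
        using C1(2)[OF x _ km] v(2) by simp
      then show ?thesis using mono C2(1) C0 unfolding C_def by linarith
    next
      case 2
      then have "angle_over k m (span {v}) \<le> real (m - k) * (\<theta> + e / 2) + C2"
        using C2(2)[OF y _ km] v(2) by simp
      then show ?thesis using mono C1(1) C0 unfolding C_def by linarith
    next
      case 3
      note x0 = 3(1) and y0 = 3(2)
      obtain \<tau> where \<tau>: "\<And>j. j \<ge> \<tau> \<Longrightarrow> norm (F j y) \<le> (\<delta> / 2) * norm (F j x)"
          "\<And>j. j + N < \<tau> \<Longrightarrow> norm (F j x) \<le> (\<delta> / 2) * norm (F j y)"
        using N[OF S1(2)[OF x] S2(2)[OF y] x0] by blast
      \<comment> \<open>Both cut points are clamped to the window. The extra 1 in
        \<open>\<tau> - N - 1\<close> is there because step \<open>j\<close> also involves time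
        \<open>Suc j\<close>, at which \<open>y\<close> must still dominate.\<close>
      define p where "p = max k (min m (\<tau> - N - 1))"
      define r where "r = max k (min m \<tau>)"
      have ord: "k \<le> p" "p \<le> r" "r \<le> m" "r - p \<le> N + 1" using km by (auto simp: p_def r_def)
      have "angle_over k p (span {v}) \<le> angle_over k p (span {y}) + real (p - k) * (e / 2)"
        by (rule angle_over_le_of_step_le[OF ord(1)], rule step) (use \<tau>(2) v y0 vxy in \<open>auto simp: p_def\<close>)
      also have "angle_over k p (span {y}) \<le> real (p - k) * (\<theta> + e / 2) + C2"
        by (rule C2(2)[OF y y0 ord(1)])
      finally have 1: "angle_over k p (span {v}) \<le> real (p - k) * (\<theta> + e) + C2"
        by (simp add: algebra_simps)
      have "angle_over p r (span {v}) \<le> real (r - p) * (pi / 2)"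
        using angle_over_bounds(2) line_dim[OF v(2)] by blast
      also have "\<dots> \<le> (real N + 1) * (pi / 2)" using ord(4) by (intro mult_right_mono) auto
      finally have 2: "angle_over p r (span {v}) \<le> (real N + 1) * (pi / 2)" .
      have "angle_over r m (span {v}) \<le> angle_over r m (span {x}) + real (m - r) * (e / 2)"
        by (rule angle_over_le_of_step_le[OF ord(3)], rule step) (use \<tau>(1) v x0 vxy in \<open>auto simp: r_def\<close>)
      also have "angle_over r m (span {x}) \<le> real (m - r) * (\<theta> + e / 2) + C1"
        by (rule C1(2)[OF x x0 ord(3)])
      finally have 3: "angle_over r m (span {v}) \<le> real (m - r) * (\<theta> + e) + C1"
        by (simp add: algebra_simps)
      have "real (p - k) * (\<theta> + e) + real (m - r) * (\<theta> + e) = (real (p - k) + real (m - r)) * (\<theta> + e)"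
        by (simp add: algebra_simps)
      \<comment> \<open>Here \<open>\<theta> \<ge> 0\<close> enters: the two outer windows omit the
        transition, so their total length is only at most \<open>m - k\<close>.\<close>
      also have "\<dots> \<le> real (m - k) * (\<theta> + e)"
        using ord \<theta> e by (intro mult_right_mono) auto
      finally show ?thesis
        using 1 2 3 angle_over_concat[OF ord(1,2)] angle_over_concat[of k r m] ord by (simp add: C_def)
    qed
  qed
  moreover have "C \<ge> 0" using C0 C1(1) C2(1) by (simp add: C_def)
  ultimately show "\<exists>C\<ge>0. \<forall>v\<in>S. v \<noteq> 0 \<longrightarrow>
     (\<forall>k m. k \<le> m \<longrightarrow> angle_over k m (span {v}) \<le> real (m - k) * (\<theta> + e) + C)" by blast
qed

section \<open>Flags of dominated splittings\<close>

text \<open>\<open>p n i\<close> is the action of the \<open>i\<close>-th stable projector at time \<open>n\<close>.\<close>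

locale dichotomy_flag = linear_flow F
  for F :: "nat \<Rightarrow> real ^ 'd \<Rightarrow> real ^ 'd" +
  fixes l :: nat and p :: "nat \<Rightarrow> nat \<Rightarrow> real ^ 'd \<Rightarrow> real ^ 'd"
  assumes splitting: "i \<in> {1..l} \<Longrightarrow> \<exists>K q. dominated_splitting F (\<lambda>n. p n (i + 1)) K q"
    and p_first: "p 0 1 x = x" and p_last: "p 0 (l + 1) x = 0"
    and p_comp: "\<lbrakk>1 \<le> i; i \<le> j; j \<le> l + 1\<rbrakk> \<Longrightarrow> p 0 i (p 0 j x) = p 0 j x"
      "\<lbrakk>1 \<le> i; i \<le> j; j \<le> l + 1\<rbrakk> \<Longrightarrow> p 0 j (p 0 i x) = p 0 j x"
begin

text \<open>The simplifier writes \<open>Suc 0\<close> and \<open>Suc l\<close> for these indices;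
  the rules are put into the same form.\<close>

lemmas p_ends = p_first[simplified] p_last[simplified]

text \<open>The spectral fiber at time 0, with the range of a projector expressed by its fixed
  points and the range of the complementary one by a kernel; see
  \<open>fiber_eq_fib\<close>.\<close>

definition fib :: "nat \<Rightarrow> (real ^ 'd) set" where
  "fib i = {x. p 0 i x = x \<and> p 0 (i + 1) x = 0}"

lemma linear_p: "i \<in> {1..l + 1} \<Longrightarrow> linear (p 0 i)"
proof (cases "i = 1")
  case True
  moreover have "p 0 1 = id" by (rule ext) (simp add: p_ends)
  ultimately show ?thesis by (simp add: linear_id)
next
  case False
  assume "i \<in> {1..l + 1}"
  then have "i - 1 \<in> {1..l}" "i - 1 + 1 = i" using False by auto
  then show ?thesis using splitting[of "i - 1"] dominated_splitting.linear_Q by metis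
qed

lemma range_p: "i \<in> {1..l + 1} \<Longrightarrow> x \<in> range (p 0 i) \<longleftrightarrow> p 0 i x = x"
  using p_comp(1)[of i i] by (metis atLeastAtMost_iff order_refl rangeE rangeI)

lemma subspace_fib: "i \<in> {1..l} \<Longrightarrow> subspace (fib i)"
  using linear_p[of i] linear_p[of "i + 1"]
  by (auto simp: subspace_def fib_def linear_0 linear_add linear_scale)

text \<open>Downward induction along the flag from \<open>range (p 0 (l + 1)) = {0}\<close>, with
  \<open>extend_to_complement\<close> as the step, which leaves the map on the deeper part
  unchanged. That the image stays in \<open>range (p 0 i)\<close> is part of the claim, because it
  makes all projectors of index at most \<open>i\<close> act trivially.\<close>

lemma exists_invariant_subspace:
  assumes V: "subspace V" "V \<subseteq> range (p 0 i)" and i: "i \<in> {1..l + 1}"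
  shows "\<exists>T e. linear T \<and> inj_on T V \<and> T ` V \<subseteq> range (p 0 i) \<and>
    (\<forall>j\<in>{1..l + 1}. p 0 j ` T ` V \<subseteq> T ` V) \<and>
    e \<longlonglongrightarrow> 0 \<and> (\<forall>n. \<forall>v\<in>V. norm (F n (T v - v)) \<le> e n * norm (F n (T v)))"
  using i V
proof (induction "l + 1 - i" arbitrary: i V)
  case 0
  then have "i = l + 1" by auto
  then have "V = {0}" using 0 subspace_0[OF 0(3)] by (auto simp: p_ends)
  moreover have "p 0 j 0 = 0" if "j \<in> {1..l + 1}" for j using linear_0[OF linear_p[OF that]] .
  ultimately show ?case using \<open>i = l + 1\<close>
    by (intro exI[of _ "\<lambda>x. x"] exI[of _ "\<lambda>n. 0"])
      (auto simp: linear_id[unfolded id_def] p_ends F_eq_0)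
next
  case (Suc n)
  then have i: "i \<in> {1..l}" by auto
  then have i1: "i + 1 \<in> {1..l + 1}" "i \<in> {1..l + 1}" by auto
  obtain K q where "dominated_splitting F (\<lambda>n. p n (i + 1)) K q" using splitting[OF i] by blast
  then interpret S: dominated_splitting F "\<lambda>n. p n (i + 1)" K q .
  let ?V0 = "V \<inter> range (p 0 (i + 1))"
  have V0: "subspace ?V0"
    by (intro subspace_inter Suc.prems linear_subspace_image linear_p i1 subspace_UNIV)
  have "n = l + 1 - (i + 1)" using Suc.hyps(2) by arith
  from Suc.hyps(1)[OF this i1(1) V0] obtain T0 e where T0e: "linear T0 \<and> inj_on T0 ?V0 \<and>
      T0 ` ?V0 \<subseteq> range (p 0 (i + 1)) \<and> (\<forall>j\<in>{1..l + 1}. p 0 j ` T0 ` ?V0 \<subseteq> T0 ` ?V0) \<and>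
      e \<longlonglongrightarrow> 0 \<and> (\<forall>n. \<forall>v\<in>?V0. norm (F n (T0 v - v)) \<le> e n * norm (F n (T0 v)))"
    by (meson Int_lower2)
  then have T0: "linear T0" "inj_on T0 ?V0" "T0 ` ?V0 \<subseteq> range (p 0 (i + 1))"
      and inv0: "\<And>j. j \<in> {1..l + 1} \<Longrightarrow> p 0 j ` T0 ` ?V0 \<subseteq> T0 ` ?V0"
      and e: "e \<longlonglongrightarrow> 0" "\<And>n v. v \<in> ?V0 \<Longrightarrow> norm (F n (T0 v - v)) \<le> e n * norm (F n (T0 v))"
    by blast+
  obtain T e' where T: "linear T" "inj_on T V" "\<And>v. v \<in> ?V0 \<Longrightarrow> T v = T0 v"
      and dec: "\<And>v. v \<in> V \<Longrightarrow> \<exists>w\<in>?V0. p 0 (i + 1) (T v) = T w \<and> T v = T w + (v - w) - p 0 (i + 1) (v - w)"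
      and e': "e' \<longlonglongrightarrow> 0" "\<And>n v. v \<in> V \<Longrightarrow> norm (F n (T v - v)) \<le> e' n * norm (F n (T v))"
    using S.extend_to_complement[OF Suc.prems(2) T0(1,2) _ e] T0(3) by blast
  have fix_i: "p 0 i v = v" if "v \<in> V" for v using that Suc.prems(3) range_p[OF i1(2)] by blast
  have Ti: "p 0 i (T v) = T v" if v: "v \<in> V" for v
  proof -
    obtain w where w: "w \<in> ?V0" "p 0 (i + 1) (T v) = T w" "T v = T w + (v - w) - p 0 (i + 1) (v - w)"
      using dec[OF v] by blast
    have "p 0 i (T w) = T w" unfolding w(2)[symmetric] using i p_comp(1)[of i "i + 1"] by simp
    moreover have "p 0 i (p 0 (i + 1) (v - w)) = p 0 (i + 1) (v - w)" using i p_comp(1)[of i "i + 1"] by simp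
    moreover have "p 0 i v = v" "p 0 i w = w" using v w(1) fix_i by auto
    ultimately show ?thesis
      unfolding w(3) by (simp add: linear_add[OF linear_p[OF i1(2)]] linear_diff[OF linear_p[OF i1(2)]])
  qed
  \<comment> \<open>For \<open>j \<le> i\<close> the projector fixes \<open>T v\<close>. For larger
    \<open>j\<close> it factors through \<open>p 0 (i + 1)\<close>, which sends \<open>T v\<close>
    into the image of \<open>?V0\<close>, invariant by induction.\<close>
  have "p 0 j (T v) \<in> T ` V" if v: "v \<in> V" and j: "j \<in> {1..l + 1}" for v j
  proof (cases "j \<le> i")
    case True
    then have "p 0 j (T v) = T v" using p_comp(1)[of j i "T v"] Ti[OF v] i j by simp
    then show ?thesis using v by auto
  next
    case False
    then have "p 0 j (T v) = p 0 j (p 0 (i + 1) (T v))" using p_comp(2)[of "i + 1" j "T v"] i j by simp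
    moreover obtain w where w: "w \<in> ?V0" "p 0 (i + 1) (T v) = T w" using dec[OF v] by blast
    ultimately have "p 0 j (T v) = p 0 j (T0 w)" using T(3)[OF w(1)] by simp
    then have "p 0 j (T v) \<in> T0 ` ?V0" using inv0[OF j] w(1) by blast
    also have "T0 ` ?V0 = T ` ?V0" using T(3) by (intro image_cong) auto
    finally show ?thesis by blast
  qed
  then have "\<forall>j\<in>{1..l + 1}. p 0 j ` T ` V \<subseteq> T ` V" by blast
  moreover have "T ` V \<subseteq> range (p 0 i)" using Ti by (metis image_subsetI rangeI)
  ultimately show ?case using T(1,2) e' by blast
qed

text \<open>The components \<open>p 0 i u - p 0 (i + 1) u\<close> stay in \<open>U\<close> by
  invariance and telescope to \<open>u\<close>, since the first projector is the identity and the
  last is 0.\<close>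

lemma invariant_direct_sum:
  assumes U: "subspace U" and inv: "\<And>j. j \<in> {1..l + 1} \<Longrightarrow> p 0 j ` U \<subseteq> U"
  shows "is_direct_sum {1..l} (\<lambda>i. U \<inter> fib i) U" "(\<Sum>i\<in>{1..l}. dim (U \<inter> fib i)) = dim U"
proof -
  have part: "p 0 i u - p 0 (i + 1) u \<in> U \<inter> fib i" if "u \<in> U" "i \<in> {1..l}" for u i
  proof -
    have "p 0 i u - p 0 (i + 1) u \<in> U" using that inv[of i] inv[of "i + 1"] by (intro subspace_diff[OF U]) auto
    moreover have "p 0 i u - p 0 (i + 1) u \<in> fib i"
      using that(2) linear_diff[OF linear_p[of i]] linear_diff[OF linear_p[of "i + 1"]]
        p_comp[of i i] p_comp[of i "i + 1"] p_comp[of "i + 1" "i + 1"] by (simp add: fib_def)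
    ultimately show ?thesis by simp
  qed
  \<comment> \<open>Differences of neighbouring projectors select one fiber and kill the others, so
    applied to a vanishing sum they isolate each term.\<close>
  have comp: "p 0 k x - p 0 (k + 1) x = (if i = k then x else 0)"
    if x: "x \<in> fib i" and i: "i \<in> {1..l}" and k: "k \<in> {1..l}" for x i k
  proof -
    have fx: "p 0 j x = x" if "1 \<le> j" "j \<le> i" for j
      using x i that p_comp(1)[of j i x] by (auto simp: fib_def)
    have zx: "p 0 j x = 0" if "i + 1 \<le> j" "j \<le> l + 1" for j
      using x i that p_comp(2)[of "i + 1" j x] linear_0[OF linear_p[of j]] by (auto simp: fib_def)
    consider "k < i" | "k = i" | "i < k" by linarith
    then show ?thesis using fx[of k] fx[of "k + 1"] zx[of k] zx[of "k + 1"] i k by cases auto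
  qed
  show "is_direct_sum {1..l} (\<lambda>i. U \<inter> fib i) U"
    unfolding is_direct_sum_def
  proof (intro conjI allI impI)
    have "u \<in> {\<Sum>i\<in>{1..l}. x i | x. \<forall>i\<in>{1..l}. x i \<in> U \<inter> fib i}" if u: "u \<in> U" for u
    proof -
      have "(\<Sum>i=1..l. p 0 i u - p 0 (i + 1) u) = - (\<Sum>i=1..l. p 0 (Suc i) u - p 0 i u)"
        by (simp add: sum_negf[symmetric])
      also have "\<dots> = u" using sum_Suc_diff[of 1 l "\<lambda>i. p 0 i u"] by (simp add: p_ends)
      finally show ?thesis using part[OF u] by force
    qed
    moreover have "(\<Sum>i\<in>{1..l}. x i) \<in> U" if "\<forall>i\<in>{1..l}. x i \<in> U \<inter> fib i" for x
      using that by (intro subspace_sum[OF U]) auto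
    ultimately show "U = {\<Sum>i\<in>{1..l}. x i | x. \<forall>i\<in>{1..l}. x i \<in> U \<inter> fib i}" by blast
  next
    fix x assume x: "(\<forall>i\<in>{1..l}. x i \<in> U \<inter> fib i) \<and> (\<Sum>i\<in>{1..l}. x i) = 0"
    show "\<forall>i\<in>{1..l}. x i = 0"
    proof
      fix k assume k: "k \<in> {1..l}"
      have lin: "linear (\<lambda>x. p 0 k x - p 0 (k + 1) x)" using k by (intro linear_compose_sub linear_p) auto
      have "0 = p 0 k (\<Sum>i\<in>{1..l}. x i) - p 0 (k + 1) (\<Sum>i\<in>{1..l}. x i)"
        using x linear_0[OF lin] by simp
      also have "\<dots> = (\<Sum>i\<in>{1..l}. p 0 k (x i) - p 0 (k + 1) (x i))" by (rule linear_sum[OF lin])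
      also have "\<dots> = (\<Sum>i\<in>{1..l}. if i = k then x i else 0)" using x comp k by (intro sum.cong) auto
      also have "\<dots> = x k" using k by simp
      finally show "x k = 0" by simp
    qed
  qed
  \<comment> \<open>Downward along the flag: each intersection is the direct sum of
    \<open>U \<inter> fib i\<close> and the next smaller intersection.\<close>
  have "dim (U \<inter> range (p 0 i)) = (\<Sum>j=i..l. dim (U \<inter> fib j))" if "i \<in> {1..l + 1}" for i
    using that
  proof (induction "l + 1 - i" arbitrary: i)
    case 0
    then have "i = l + 1" by auto
    then have "U \<inter> range (p 0 i) \<subseteq> {0}" by (auto simp: p_ends)
    then show ?case using \<open>i = l + 1\<close> by (simp add: dim_eq_0)
  next
    case (Suc n)
    then have i: "i \<in> {1..l}" by auto
    let ?X = "U \<inter> fib i" and ?Y = "U \<inter> range (p 0 (i + 1))"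
    have Y: "y \<in> ?Y \<longleftrightarrow> y \<in> U \<and> p 0 (i + 1) y = y" for y using range_p[of "i + 1"] i by auto
    have Z: "y \<in> U \<inter> range (p 0 i) \<longleftrightarrow> y \<in> U \<and> p 0 i y = y" for y using range_p[of i] i by auto
    have eq: "{x + y | x y. x \<in> ?X \<and> y \<in> ?Y} = U \<inter> range (p 0 i)"
    proof (intro equalityI subsetI)
      fix z assume "z \<in> {x + y | x y. x \<in> ?X \<and> y \<in> ?Y}"
      then obtain x y where z: "z = x + y" "x \<in> U" "p 0 i x = x" "y \<in> U" "p 0 (i + 1) y = y"
        using Y by (auto simp: fib_def)
      have "p 0 i y = y" using p_comp(1)[of i "i + 1" y] i z(5) by simp
      then show "z \<in> U \<inter> range (p 0 i)"
        unfolding Z using z subspace_add[OF U] linear_add[OF linear_p[of i]] i by auto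
    next
      fix z assume "z \<in> U \<inter> range (p 0 i)"
      then have z: "z \<in> U" "p 0 i z = z" unfolding Z by auto
      have "z = (p 0 i z - p 0 (i + 1) z) + p 0 (i + 1) z" using z(2) by simp
      moreover have "p 0 (i + 1) z \<in> ?Y" using inv[of "i + 1"] i z(1) by auto
      ultimately show "z \<in> {x + y | x y. x \<in> ?X \<and> y \<in> ?Y}" using part[OF z(1) i] by blast
    qed
    have sub: "subspace ?X" "subspace ?Y"
      using i by (auto intro!: subspace_inter U subspace_fib linear_subspace_image linear_p subspace_UNIV)
    have "?X \<inter> ?Y \<subseteq> {0}"
    proof
      fix z assume "z \<in> ?X \<inter> ?Y"
      then have "p 0 (i + 1) z = 0" "p 0 (i + 1) z = z" using Y[of z] by (auto simp: fib_def)
      then show "z \<in> {0}" by simp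
    qed
    then have "dim (?X \<inter> ?Y) = 0" by (simp only: dim_eq_0)
    then have "dim (U \<inter> range (p 0 i)) = dim ?X + dim ?Y"
      using dim_sums_Int[OF sub] unfolding eq by linarith
    also have "dim ?Y = (\<Sum>j=i + 1..l. dim (U \<inter> fib j))" using Suc i by (intro Suc.hyps) auto
    finally show ?case using i by (simp add: sum.atLeast_Suc_atMost)
  qed
  from this[of 1] show "(\<Sum>i\<in>{1..l}. dim (U \<inter> fib i)) = dim U"
    using p_ends(1) by (simp add: image_def)
qed

lemma exists_asymptotic_invariant_subspace:
  assumes V: "subspace V" "1 \<le> dim V"
  obtains U where "subspace U" "dim U = dim V" "\<And>j. j \<in> {1..l + 1} \<Longrightarrow> p 0 j ` U \<subseteq> U"
    "\<And>e. e > 0 \<Longrightarrow> \<exists>C. \<forall>k n. \<bar>angle_over k (k + n) V - angle_over k (k + n) U\<bar> \<le> real n * e + C"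
proof -
  have "V \<subseteq> range (p 0 1)" using p_first by (metis rangeI subsetI)
  then obtain T e where T: "linear T" "inj_on T V" "\<And>j. j \<in> {1..l + 1} \<Longrightarrow> p 0 j ` T ` V \<subseteq> T ` V"
      and e: "e \<longlonglongrightarrow> 0" "\<And>n v. v \<in> V \<Longrightarrow> norm (F n (T v - v)) \<le> e n * norm (F n (T v))"
    using exists_invariant_subspace[OF V(1), of 1] by auto
  have TV: "subspace (T ` V)" by (rule linear_subspace_image[OF T(1) V(1)])
  have dT: "dim (T ` V) = dim V" using dim_image_eq[OF T(1)] T(2) V(1) by (metis span_eq_iff)
  have "(\<lambda>n. 2 * e n) \<longlonglongrightarrow> 2 * 0" by (intro tendsto_intros e(1))
  then have "(\<lambda>n. 2 * e n) \<longlonglongrightarrow> 0" by simp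
  then show thesis
    using that[OF TV dT T(3)] angle_over_diff_of_close[OF V TV _ _ sphere_close_image[OF V(1) T(1,2) e(2)]] dT V(2)
    by simp
qed

text \<open>Each induction step adds one fiber without raising \<open>\<theta>\<close>: up to a
  bounded transition, a trajectory follows one of its two components at a time, so rates combine as
  a maximum.\<close>

lemma angle_growth_UNIV:
  assumes \<theta>: "\<theta> \<ge> 0" and fib: "\<And>i. i \<in> {1..l} \<Longrightarrow> angle_growth (fib i) \<theta>"
  shows "angle_growth UNIV \<theta>"
proof -
  have "angle_growth (range (p 0 i)) \<theta>" if "i \<in> {1..l + 1}" for i
    using that
  proof (induction "l + 1 - i" arbitrary: i)
    case 0
    then have "i = l + 1" by auto
    then show ?case by (auto simp: angle_growth_def p_ends intro!: exI[of _ 0])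
  next
    case (Suc n)
    then have i: "i \<in> {1..l}" by auto
    obtain K q where "dominated_splitting F (\<lambda>n. p n (i + 1)) K q" using splitting[OF i] by blast
    then interpret S: dominated_splitting F "\<lambda>n. p n (i + 1)" K q .
    show ?case
    proof (rule S.angle_growth_sum[OF fib[OF i] _ _ _ _ \<theta>])
      show "angle_growth (range (p 0 (i + 1))) \<theta>" using Suc by auto
      show "p 0 (i + 1) x = 0" if "x \<in> fib i" for x using that by (simp add: fib_def)
      show "p 0 (i + 1) y = y" if "y \<in> range (p 0 (i + 1))" for y
        using that range_p[of "i + 1"] i by auto
      show "\<exists>x\<in>fib i. \<exists>y\<in>range (p 0 (i + 1)). v = x + y" if "v \<in> range (p 0 i)" for v
      proof -
        have "p 0 i v = v" using that range_p[of i] i by auto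
        then have "v - p 0 (i + 1) v \<in> fib i"
          using linear_diff[OF linear_p[of i]] linear_diff[OF linear_p[of "i + 1"]] i
            p_comp[of i "i + 1"] p_comp[of "i + 1" "i + 1"] by (simp add: fib_def)
        then show ?thesis by (intro bexI[of _ "v - p 0 (i + 1) v"] bexI[of _ "p 0 (i + 1) v"]) auto
      qed
    qed
  qed
  from this[of 1] show ?thesis using p_ends(1) by (simp add: image_def)
qed

section \<open>Inner angular values as growth rates of families of lines\<close>

definition lines :: "(real ^ 'd) set \<Rightarrow> (real ^ 'd) set set" where
  "lines S = (\<lambda>v. span {v}) ` (S - {0})"

text \<open>The first upper uniform inner value on \<open>S\<close>, with the factor
  \<open>1 / n\<close> taken out of the suprema; indexing by \<open>lines S\<close> makes the lemmas
  on families of subspaces applicable.\<close>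

definition growth_rate :: "(real ^ 'd) set \<Rightarrow> real" where
  "growth_rate S = lim (\<lambda>n. (SUP V\<in>lines S. SUP k. angle_over k (k + n) V) / real n)"

lemma lines_dim: "V \<in> lines S \<Longrightarrow> subspace V \<and> 1 \<le> dim V"
  using line_dim by (auto simp: lines_def)

lemma growth_rate_LIMSEQ:
  assumes "lines S \<noteq> {}"
  shows "(\<lambda>n. (SUP V\<in>lines S. SUP k. angle_over k (k + n) V) / real n) \<longlonglongrightarrow> growth_rate S"
  unfolding growth_rate_def
  by (rule convergent_LIMSEQ_iff[THEN iffD1, OF convergent_sup_angle_over[OF assms lines_dim]])

lemma growth_rate_nonneg:
  assumes "lines S \<noteq> {}"
  shows "0 \<le> growth_rate S"
proof (rule LIMSEQ_le_const[OF growth_rate_LIMSEQ[OF assms]], intro exI allI impI)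
  fix n :: nat
  obtain V where V: "V \<in> lines S" using assms by auto
  have "0 \<le> angle_over 0 (0 + n) V" using angle_over_bounds(1) lines_dim[OF V] by blast
  also have "\<dots> \<le> (SUP V\<in>lines S. SUP k. angle_over k (k + n) V)"
    by (rule sup_angle_over(2)[OF assms lines_dim V])
  finally show "0 \<le> (SUP V\<in>lines S. SUP k. angle_over k (k + n) V) / real n" by simp
qed

lemma growth_rate_mono:
  assumes "lines S \<noteq> {}" "S \<subseteq> S'"
  shows "growth_rate S \<le> growth_rate S'"
proof -
  have sub: "lines S \<subseteq> lines S'" using assms(2) by (auto simp: lines_def)
  then have ne: "lines S' \<noteq> {}" using assms(1) by auto
  have "(SUP V\<in>lines S. SUP k. angle_over k (k + n) V) \<le> (SUP V\<in>lines S'. SUP k. angle_over k (k + n) V)" for n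
    by (rule sup_angle_over(1)[OF assms(1) lines_dim])
      (use sub sup_angle_over(2)[OF ne lines_dim] in auto)
  then show ?thesis
    by (intro LIMSEQ_le[OF growth_rate_LIMSEQ[OF assms(1)] growth_rate_LIMSEQ[OF ne]] exI allI impI
        divide_right_mono) auto
qed

text \<open>In one direction the additive constant vanishes after division by \<open>n\<close>. In
  the other, long windows obey the limit up to \<open>e\<close> and short ones are absorbed into the
  constant.\<close>

lemma angle_growth_iff_growth_rate:
  assumes ne: "lines S \<noteq> {}" and \<theta>: "0 \<le> \<theta>"
  shows "angle_growth S \<theta> \<longleftrightarrow> growth_rate S \<le> \<theta>"
proof
  let ?U = "\<lambda>n. SUP V\<in>lines S. SUP k. angle_over k (k + n) V"
  assume g: "angle_growth S \<theta>"
  show "growth_rate S \<le> \<theta>"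
  proof (rule field_le_epsilon)
    fix e :: real assume "e > 0"
    then obtain C where C: "\<And>v k m. v \<in> S \<Longrightarrow> v \<noteq> 0 \<Longrightarrow> k \<le> m \<Longrightarrow>
        angle_over k m (span {v}) \<le> real (m - k) * (\<theta> + e) + C"
      using g unfolding angle_growth_def by meson
    have U: "?U n \<le> real n * (\<theta> + e) + C" for n
    proof (rule sup_angle_over(1)[OF ne lines_dim])
      fix V k assume "V \<in> lines S"
      then obtain v where "v \<in> S" "v \<noteq> 0" "V = span {v}" by (auto simp: lines_def)
      then show "angle_over k (k + n) V \<le> real n * (\<theta> + e) + C" using C[of v k "k + n"] by simp
    qed
    have "?U n / real n \<le> (\<theta> + e) + C / real n" if "n \<ge> 1" for n
    proof -
      have "?U n / real n \<le> (real n * (\<theta> + e) + C) / real n" by (intro divide_right_mono U) auto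
      then show ?thesis using that by (simp add: add_divide_distrib)
    qed
    moreover have "(\<lambda>n. (\<theta> + e) + C / real n) \<longlonglongrightarrow> (\<theta> + e) + 0" by (intro tendsto_intros lim_const_over_n)
    ultimately have "growth_rate S \<le> (\<theta> + e) + 0"
      using growth_rate_LIMSEQ[OF ne] by (intro LIMSEQ_le) auto
    then show "growth_rate S \<le> \<theta> + e" by simp
  qed
next
  let ?U = "\<lambda>n. SUP V\<in>lines S. SUP k. angle_over k (k + n) V"
  assume le: "growth_rate S \<le> \<theta>"
  show "angle_growth S \<theta>"
    unfolding angle_growth_def
  proof (intro allI impI)
    fix e :: real assume e: "e > 0"
    then have "\<forall>\<^sub>F n in sequentially. ?U n / real n < \<theta> + e"
      using le by (intro order_tendstoD(2)[OF growth_rate_LIMSEQ[OF ne]]) auto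
    then obtain N where N: "\<And>n. n \<ge> N \<Longrightarrow> ?U n / real n < \<theta> + e" by (auto simp: eventually_sequentially)
    have C0: "0 \<le> real (Suc N) * (pi / 2)" by simp
    have "angle_over k m (span {v}) \<le> real (m - k) * (\<theta> + e) + real (Suc N) * (pi / 2)"
      if v: "v \<in> S" "v \<noteq> 0" and km: "k \<le> m" for v k m
    \<comment> \<open>\<open>Suc N\<close> instead of \<open>N\<close> ensures a positive window
      length, by which the estimate can be multiplied.\<close>
    proof (cases "m - k \<ge> Suc N")
      case True
      have "span {v} \<in> lines S" using v by (auto simp: lines_def)
      then have "angle_over k (k + (m - k)) (span {v}) \<le> ?U (m - k)"
        using lines_dim by (intro sup_angle_over(2)[OF ne])
      moreover have "?U (m - k) \<le> real (m - k) * (\<theta> + e)"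
        using N[of "m - k"] True by (simp add: pos_divide_less_eq mult.commute less_imp_le)
      ultimately show ?thesis using C0 unfolding le_add_diff_inverse[OF km] by linarith
    next
      case False
      have "angle_over k m (span {v}) \<le> real (m - k) * (pi / 2)"
        using angle_over_bounds(2) line_dim[OF v(2)] by blast
      also have "\<dots> \<le> real (Suc N) * (pi / 2)" using False by (intro mult_right_mono) auto
      also have "\<dots> \<le> real (m - k) * (\<theta> + e) + real (Suc N) * (pi / 2)" using \<theta> e by simp
      finally show ?thesis .
    qed
    then show "\<exists>C\<ge>0. \<forall>v\<in>S. v \<noteq> 0 \<longrightarrow>
       (\<forall>k m. k \<le> m \<longrightarrow> angle_over k m (span {v}) \<le> real (m - k) * (\<theta> + e) + C)"
      using C0 by blast
  qed
qed

text \<open>The maximum is a common bound \<open>\<theta>\<close> for all fibers, which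
  \<open>angle_growth_UNIV\<close> carries to the whole space; the converse is monotonicity.
  Nontrivial fibers keep the suprema nonempty.\<close>

lemma growth_rate_UNIV:
  assumes l: "1 \<le> l" and fib: "\<And>i. i \<in> {1..l} \<Longrightarrow> fib i \<noteq> {0}"
  shows "growth_rate UNIV = Max ((\<lambda>i. growth_rate (fib i)) ` {1..l})"
proof -
  have ne: "lines (fib i) \<noteq> {}" if "i \<in> {1..l}" for i
    using fib[OF that] subspace_0[OF subspace_fib[OF that]] by (auto simp: lines_def)
  have neU: "lines UNIV \<noteq> {}" using ne[of 1] l by (auto simp: lines_def)
  let ?M = "Max ((\<lambda>i. growth_rate (fib i)) ` {1..l})"
  have le: "growth_rate (fib i) \<le> ?M" if "i \<in> {1..l}" for i using that by (intro Max_ge) auto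
  have "1 \<in> {1..l}" using l by simp
  then have M0: "0 \<le> ?M" using growth_rate_nonneg[OF ne] le order_trans by blast
  have "growth_rate UNIV \<le> ?M"
    using angle_growth_UNIV[OF M0] angle_growth_iff_growth_rate[OF ne M0] le
      angle_growth_iff_growth_rate[OF neU M0] by blast
  moreover have "?M \<le> growth_rate UNIV"
    using growth_rate_mono[OF ne] l by (intro Max.boundedI) auto
  ultimately show ?thesis by simp
qed

lemma grassmannian_1: "grassmannian 1 = lines (UNIV :: (real ^ 'd) set)"
proof (intro equalityI subsetI)
  fix V :: "(real ^ 'd) set" assume "V \<in> grassmannian 1"
  then have V: "subspace V" "dim V = 1" by (auto simp: grassmannian_def)
  then obtain v where v: "v \<in> V" "v \<noteq> 0" using dim_eq_0[of V] by auto
  have "span {v} = V"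
    using V v by (intro subspace_dim_equal) (auto simp: span_minimal)
  then show "V \<in> lines UNIV" using v by (auto simp: lines_def)
next
  fix V :: "(real ^ 'd) set" assume "V \<in> lines UNIV"
  then show "V \<in> grassmannian 1" by (auto simp: lines_def grassmannian_def)
qed

end

section \<open>Systems with a dichotomy spectrum\<close>

text \<open>Used with \<open>c = 1 / real n\<close>, so \<open>c = 0\<close> has to be allowed: it
  is the value at \<open>n = 0\<close>.\<close>

lemma cSUP_cmult:
  fixes f :: "'a \<Rightarrow> real"
  assumes "0 \<le> c" "S \<noteq> {}" "bdd_above (f ` S)"
  shows "(SUP x\<in>S. c * f x) = c * (SUP x\<in>S. f x)"
proof -
  have "c * Sup (f ` S) = (SUP y\<in>f ` S. c * y)"
    by (rule continuous_at_Sup_mono) (use assms in \<open>auto intro!: monoI mult_left_mono continuous_intros\<close>)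
  then show ?thesis by (simp add: image_image)
qed

lemma cINF_cmult:
  fixes f :: "'a \<Rightarrow> real"
  assumes "0 \<le> c" "S \<noteq> {}" "bdd_below (f ` S)"
  shows "(INF x\<in>S. c * f x) = c * (INF x\<in>S. f x)"
proof -
  have "c * Inf (f ` S) = (INF y\<in>f ` S. c * y)"
    by (rule continuous_at_Inf_mono) (use assms in \<open>auto intro!: monoI mult_left_mono continuous_intros\<close>)
  then show ?thesis by (simp add: image_image)
qed

section \<open>Matrix inverses, spectral norm and the rescaled solution operator\<close>

lemma matrix_inv_mult:
  fixes M :: "real ^ 'd ^ 'd"
  assumes "invertible M"
  shows "M ** matrix_inv M = mat 1" "matrix_inv M ** M = mat 1"
proof -
  have "M ** matrix_inv M = mat 1 \<and> matrix_inv M ** M = mat 1"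
    unfolding matrix_inv_def using assms unfolding invertible_def by (rule someI_ex)
  then show "M ** matrix_inv M = mat 1" "matrix_inv M ** M = mat 1" by auto
qed

lemma matrix_scaleR_mult:
  fixes M N :: "real ^ 'd ^ 'd"
  shows "(c *\<^sub>R M) ** N = c *\<^sub>R (M ** N)" "M ** (c *\<^sub>R N) = c *\<^sub>R (M ** N)"
  by (simp_all add: matrix_matrix_mult_def sum_distrib_left mult_ac vec_eq_iff)

lemma matrix_inv_scaleR:
  fixes M :: "real ^ 'd ^ 'd"
  assumes M: "invertible M" and c: "c \<noteq> 0"
  shows "matrix_inv (c *\<^sub>R M) = (1 / c) *\<^sub>R matrix_inv M"
proof -
  have "(c *\<^sub>R M) ** ((1 / c) *\<^sub>R matrix_inv M) = mat 1" "((1 / c) *\<^sub>R matrix_inv M) ** (c *\<^sub>R M) = mat 1"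
    using c by (simp_all add: matrix_scaleR_mult matrix_inv_mult[OF M])
  then have "invertible (c *\<^sub>R M)" unfolding invertible_def by blast
  then have "matrix_inv (c *\<^sub>R M) = matrix_inv (c *\<^sub>R M) ** ((c *\<^sub>R M) ** ((1 / c) *\<^sub>R matrix_inv M))"
    using \<open>(c *\<^sub>R M) ** ((1 / c) *\<^sub>R matrix_inv M) = mat 1\<close> by simp
  also have "\<dots> = (1 / c) *\<^sub>R matrix_inv M"
    unfolding matrix_mul_assoc matrix_inv_mult(2)[OF \<open>invertible (c *\<^sub>R M)\<close>] by simp
  finally show ?thesis .
qed

lemma spectral_norm_bound: "norm (M *v x) \<le> spectral_norm M * norm x"
  unfolding spectral_norm_def by (rule onorm[OF matrix_vector_mul_bounded_linear])

lemma spectral_norm_scaleR: "spectral_norm (c *\<^sub>R M) = \<bar>c\<bar> * spectral_norm M"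
  unfolding spectral_norm_def scaleR_matrix_vector_assoc[symmetric]
  by (rule onorm_scaleR[OF matrix_vector_mul_bounded_linear])

lemma spectral_norm_nonneg: "0 \<le> spectral_norm M"
  unfolding spectral_norm_def by (rule onorm_pos_le[OF matrix_vector_mul_bounded_linear])

lemma backward_forward:
  assumes "\<And>n. invertible (A n)"
  shows "backward_op A m k ** forward_op A m k = mat 1"
proof (induction k)
  case (Suc k)
  have "backward_op A m (Suc k) ** forward_op A m (Suc k)
      = backward_op A m k ** (matrix_inv (A (m + k)) ** A (m + k)) ** forward_op A m k"
    by (simp add: matrix_mul_assoc)
  then show ?case using Suc by (simp add: matrix_inv_mult assms)
qed simp

lemma forward_op_add: "forward_op A (m + j) k ** forward_op A m j = forward_op A m (j + k)"
  by (induction k) (simp_all add: add.assoc matrix_mul_assoc[symmetric])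

lemma solution_op_compose: "m \<le> n \<Longrightarrow> solution_op A n m ** solution_op A m 0 = solution_op A n 0"
  using forward_op_add[of A 0 m "n - m"] by (simp add: solution_op_def)

lemma solution_op_inverse:
  assumes "\<And>n. invertible (A n)" "m \<le> n"
  shows "solution_op A m n ** solution_op A n m = mat 1"
  using backward_forward[of A m "n - m", OF assms(1)] assms(2)
  by (cases "m = n") (simp_all add: solution_op_def)

lemma solution_op_self: "solution_op A n n = mat 1"
  by (simp add: solution_op_def)

text \<open>Raising \<open>\<gamma>\<close> damps forward evolution and lowering it damps backward
  evolution; \<open>fib_nontrivial\<close> uses both to combine dichotomies at two
  parameters.\<close>

lemma solution_op_scaled:
  assumes inv: "\<And>n. invertible (A n)" and \<gamma>: "\<gamma> > 0" "\<gamma>' > 0" and mn: "m \<le> n"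
  shows "solution_op (scaled \<gamma> A) n m = (\<gamma>' / \<gamma>) ^ (n - m) *\<^sub>R solution_op (scaled \<gamma>' A) n m"
    "solution_op (scaled \<gamma> A) m n = (\<gamma> / \<gamma>') ^ (n - m) *\<^sub>R solution_op (scaled \<gamma>' A) m n"
proof -
  have f: "forward_op (scaled \<gamma> A) m k = (\<gamma>' / \<gamma>) ^ k *\<^sub>R forward_op (scaled \<gamma>' A) m k" for k
    by (induction k) (use \<gamma> in \<open>simp_all add: scaled_def matrix_scaleR_mult\<close>)
  have b: "backward_op (scaled \<gamma> A) m k = (\<gamma> / \<gamma>') ^ k *\<^sub>R backward_op (scaled \<gamma>' A) m k" for k
    by (induction k) (use \<gamma> in \<open>simp_all add: scaled_def matrix_scaleR_mult matrix_inv_scaleR[OF inv]\<close>)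
  show "solution_op (scaled \<gamma> A) n m = (\<gamma>' / \<gamma>) ^ (n - m) *\<^sub>R solution_op (scaled \<gamma>' A) n m"
    using mn f by (simp add: solution_op_def)
  show "solution_op (scaled \<gamma> A) m n = (\<gamma> / \<gamma>') ^ (n - m) *\<^sub>R solution_op (scaled \<gamma>' A) m n"
  proof (cases "m = n")
    case False
    then have "\<not> n \<le> m" using mn by simp
    then show ?thesis unfolding solution_op_def using b[of "n - m"] by simp
  qed (simp add: solution_op_def)
qed

lemma scaled_1: "scaled 1 A = A"
  by (rule ext) (simp add: scaled_def)

section \<open>Projector algebra and dominated splittings from the dichotomy spectrum\<close>

locale dichotomy_spectrum_system =
  fixes A :: "nat \<Rightarrow> real ^ 'd ^ 'd" and l :: nat and \<sigma>m \<sigma>p :: "nat \<Rightarrow> real"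
    and P :: "nat \<Rightarrow> nat \<Rightarrow> real ^ 'd ^ 'd"
  assumes invertible_A: "invertible (A n)"
    and spectrum: "has_dichotomy_spectrum A l \<sigma>m \<sigma>p"
    and projectors: "dichotomy_projectors A l \<sigma>m \<sigma>p P"
begin

abbreviation F :: "nat \<Rightarrow> real ^ 'd \<Rightarrow> real ^ 'd" where "F n \<equiv> (*v) (solution_op A n 0)"
abbreviation p :: "nat \<Rightarrow> nat \<Rightarrow> real ^ 'd \<Rightarrow> real ^ 'd" where "p n i \<equiv> (*v) (P n i)"

lemma l: "1 \<le> l" using spectrum by (simp add: has_dichotomy_spectrum_def)

lemma \<sigma>_last: "\<sigma>p (l + 1) = 0" using spectrum by (simp add: has_dichotomy_spectrum_def)

lemma \<sigma>_order: "i \<in> {1..l} \<Longrightarrow> \<sigma>p (i + 1) < \<sigma>m i" "i \<in> {1..l} \<Longrightarrow> \<sigma>m i \<le> \<sigma>p i"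
  using spectrum by (simp_all add: has_dichotomy_spectrum_def)

lemma \<sigma>p_nonneg: "i \<in> {1..l + 1} \<Longrightarrow> 0 \<le> \<sigma>p i"
proof (induction "l + 1 - i" arbitrary: i)
  case 0
  then have "i = l + 1" by auto
  then show ?case using \<sigma>_last by simp
next
  case (Suc n)
  then have "i \<in> {1..l}" by auto
  moreover have "0 \<le> \<sigma>p (i + 1)" using Suc by (intro Suc.hyps) auto
  ultimately show ?case using \<sigma>_order[of i] by linarith
qed

lemma \<sigma>m_pos: "i \<in> {1..l} \<Longrightarrow> 0 < \<sigma>m i"
  using \<sigma>_order(1)[of i] \<sigma>p_nonneg[of "i + 1"] by auto

text \<open>Together with \<open>resolvent_below\<close> this supplies parameters on both sides of
  \<open>\<sigma>m i\<close> from the two resolvent intervals next to the spectral interval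
  \<open>i\<close>. The case \<open>i = 1\<close> is separate because its interval is
  unbounded.\<close>

lemma resolvent_above:
  assumes "i \<in> {1..l}"
  shows "\<exists>\<gamma>\<in>resolvent_interval \<sigma>m \<sigma>p i. \<sigma>m i < \<gamma>"
proof (cases "i = 1")
  case True
  then show ?thesis using \<sigma>_order(2)[OF assms]
    by (intro bexI[of _ "\<sigma>p 1 + 1"]) (auto simp: resolvent_interval_def)
next
  case False
  then have "i - 1 \<in> {1..l}" "i - 1 + 1 = i" using assms by auto
  then have "\<sigma>p i < \<sigma>m (i - 1)" using \<sigma>_order(1)[of "i - 1"] by simp
  then obtain \<gamma> where "\<sigma>p i < \<gamma>" "\<gamma> < \<sigma>m (i - 1)" using dense by blast
  then have "\<gamma> \<in> resolvent_interval \<sigma>m \<sigma>p i" "\<sigma>m i < \<gamma>"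
    using False \<sigma>_order(2)[OF assms] by (simp_all add: resolvent_interval_def)
  then show ?thesis by blast
qed

lemma resolvent_below:
  assumes "i \<in> {1..l}"
  shows "\<exists>\<gamma>\<in>resolvent_interval \<sigma>m \<sigma>p (i + 1). 0 < \<gamma> \<and> \<gamma> < \<sigma>m i"
proof -
  obtain \<gamma> where \<gamma>: "\<sigma>p (i + 1) < \<gamma>" "\<gamma> < \<sigma>m i" using dense[OF \<sigma>_order(1)[OF assms]] by blast
  have "0 \<le> \<sigma>p (i + 1)" by (rule \<sigma>p_nonneg) (use assms in simp)
  then have "0 < \<gamma>" using \<gamma> by linarith
  moreover have "\<gamma> \<in> resolvent_interval \<sigma>m \<sigma>p (i + 1)"
    using \<gamma> assms by (simp add: resolvent_interval_def)
  ultimately show ?thesis using \<gamma> by blast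
qed

lemmas projectors' = projectors[unfolded dichotomy_projectors_def]
lemmas resolvent_dichotomies = projectors'[THEN conjunct1]
  and projector_commute = projectors'[THEN conjunct2, THEN conjunct1]
  and projector_estimates = projectors'[THEN conjunct2, THEN conjunct2, THEN conjunct1]
  and stable_ranges = projectors'[THEN conjunct2, THEN conjunct2, THEN conjunct2, THEN conjunct1]
  and unstable_ranges = projectors'[THEN conjunct2, THEN conjunct2, THEN conjunct2, THEN conjunct2]

lemma exp_dichotomy_resolvent:
  "\<lbrakk>i \<in> {1..l + 1}; \<gamma> \<in> resolvent_interval \<sigma>m \<sigma>p i\<rbrakk>
    \<Longrightarrow> exp_dichotomy_with (solution_op (scaled \<gamma> A)) (\<lambda>n. P n i)"
  using resolvent_dichotomies by blast

text \<open>Idempotence is stated only within a dichotomy at some \<open>\<gamma>\<close>, so the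
  resolvent interval must be shown to be nonempty.\<close>

lemma P_idem: "i \<in> {1..l + 1} \<Longrightarrow> P n i ** P n i = P n i"
proof -
  assume i: "i \<in> {1..l + 1}"
  have "\<exists>\<gamma>. \<gamma> \<in> resolvent_interval \<sigma>m \<sigma>p i"
  proof (cases "i = 1")
    case True
    then show ?thesis using resolvent_above[of 1] l by auto
  next
    case False
    then have "i - 1 \<in> {1..l}" "i - 1 + 1 = i" using i by auto
    then show ?thesis using resolvent_below[of "i - 1"] by auto
  qed
  then show ?thesis using exp_dichotomy_resolvent[OF i] unfolding exp_dichotomy_with_def by blast
qed

lemma p_idem: "i \<in> {1..l + 1} \<Longrightarrow> p n i (p n i x) = p n i x"
  using P_idem by (simp add: matrix_vector_mul_assoc)

lemma P_commute:
  assumes "i \<in> {1..l + 1}"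
  shows "P n i ** solution_op A n m = solution_op A n m ** P m i"
    "(mat 1 - P n i) ** solution_op A n m = solution_op A n m ** (mat 1 - P m i)"
  using projector_commute assms by blast+

lemma compl_vec: "(mat 1 - M) *v x = x - M *v (x :: real ^ 'd)"
  by (simp add: matrix_vector_mult_diff_rdistrib)

lemma range_incl:
  "range (p n (l + 1)) = {0}" "range (p n 1) = UNIV"
  "i \<in> {1..l} \<Longrightarrow> range (p n (i + 1)) \<subseteq> range (p n i)"
  "i \<in> {1..l} \<Longrightarrow> range ((*v) (mat 1 - P n i)) \<subseteq> range ((*v) (mat 1 - P n (i + 1)))"
  using stable_ranges unstable_ranges by blast+

lemma p_last: "p n (l + 1) x = 0" using range_incl(1)[of n] by blast

lemma p_first: "p n 1 x = x"
proof -
  obtain y where "x = p n 1 y" using range_incl(2)[of n] by blast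
  then show ?thesis using p_idem[of 1 n y] by simp
qed

text \<open>The first identity comes from the nested stable ranges, the second from the nested
  unstable ranges, which are the kernels.\<close>

lemma p_Suc:
  assumes "i \<in> {1..l}"
  shows "p n i (p n (i + 1) x) = p n (i + 1) x" "p n (i + 1) (p n i x) = p n (i + 1) x"
proof -
  have i: "i \<in> {1..l + 1}" "i + 1 \<in> {1..l + 1}" using assms by auto
  obtain y where "p n (i + 1) x = p n i y" using range_incl(3)[OF assms, of n] by blast
  then show "p n i (p n (i + 1) x) = p n (i + 1) x" using p_idem[OF i(1)] by simp
  obtain z where "x - p n i x = z - p n (i + 1) z"
    using range_incl(4)[OF assms, of n] unfolding compl_vec by blast
  then have "p n (i + 1) (x - p n i x) = 0"
    using p_idem[OF i(2), of n z] by (simp add: matrix_vector_mult_diff_distrib)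
  then show "p n (i + 1) (p n i x) = p n (i + 1) x" by (simp add: matrix_vector_mult_diff_distrib)
qed

lemma p_comp:
  assumes "1 \<le> i" "i \<le> j" "j \<le> l + 1"
  shows "p n i (p n j x) = p n j x \<and> p n j (p n i x) = p n j x"
  using assms(2,3)
proof (induction j arbitrary: x rule: dec_induct)
  case base
  then show ?case using p_idem[of i n x] assms by simp
next
  case (step j)
  then have j: "j \<in> {1..l}" using assms(1) by auto
  have IH: "p n i (p n j y) = p n j y" "p n j (p n i y) = p n j y" for y
    using step by simp_all
  show ?case
    using IH[of "p n (j + 1) x"] IH[of x] p_Suc[OF j, of n x] p_Suc[OF j, of n "p n i x"] by simp
qed

lemma inverse_F: "solution_op A 0 n *v F n x = x"
  using solution_op_inverse[of A 0 n] invertible_A by (simp add: matrix_vector_mul_assoc)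

sublocale linear_flow F
proof (rule linear_flow.intro)
  show "linear (F n)" for n by (rule matrix_vector_mul_linear)
  show "inj (F n)" for n by (rule inj_on_inverseI[of _ "(*v) (solution_op A 0 n)"]) (rule inverse_F)
  show "F 0 x = x" for x by (simp add: solution_op_self)
qed

lemma p_F: "i \<in> {1..l + 1} \<Longrightarrow> p n i (F n x) = F n (p 0 i x)"
  using P_commute(1)[of i n 0] by (simp add: matrix_vector_mul_assoc)

text \<open>Below the gap solutions grow at most like powers of \<open>\<sigma>p (i + 1)\<close>,
  above it at least like powers of \<open>\<sigma>m i\<close>; multiplying the two estimates gives
  domination with their quotient, which is less than 1.\<close>

lemma dominated_splitting_P:
  assumes i: "i \<in> {1..l}"
  shows "\<exists>K q. dominated_splitting F (\<lambda>n. p n (i + 1)) K q"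
proof -
  obtain K where K: "K > 0"
    and est: "\<forall>m n. m \<le> n \<longrightarrow>
        (\<forall>i\<in>{1..l}. spectral_norm (solution_op A n m ** P m i) \<le> K * \<sigma>p i ^ (n - m)) \<and>
        (\<forall>i\<in>{2..l + 1}. spectral_norm (solution_op A m n ** (mat 1 - P n i))
            \<le> K * \<sigma>m (i - 1) powi (int m - int n))"
    using projector_estimates by blast
  have st: "\<And>m n i. m \<le> n \<Longrightarrow> i \<in> {1..l} \<Longrightarrow> spectral_norm (solution_op A n m ** P m i) \<le> K * \<sigma>p i ^ (n - m)"
    using est by blast
  have un: "\<And>m n i. m \<le> n \<Longrightarrow> i \<in> {2..l + 1} \<Longrightarrow> spectral_norm (solution_op A m n ** (mat 1 - P n i))
            \<le> K * \<sigma>m (i - 1) powi (int m - int n)"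
    using est by blast
  \<comment> \<open>The locale has a single constant: \<open>K\<close> is needed for the projector
    bound and \<open>K * K\<close> for the product of the two estimates.\<close>
  let ?j = "i + 1" and ?K = "K + K * K" and ?q = "\<sigma>p (i + 1) / \<sigma>m i"
  have j: "?j \<in> {1..l + 1}" using i by auto
  have K': "K \<le> ?K" "K * K \<le> ?K" "0 < ?K" using K by (auto intro: add_pos_pos)
  have \<sigma>: "0 < \<sigma>m i" "0 \<le> \<sigma>p ?j" "\<sigma>p ?j < \<sigma>m i"
    using \<sigma>m_pos[OF i] \<sigma>p_nonneg[OF j] \<sigma>_order(1)[OF i] by auto
  have stable: "norm (F n y) \<le> K * \<sigma>p ?j ^ (n - m) * norm (F m y)" if y: "p 0 ?j y = y" and mn: "m \<le> n" for y m n
  \<comment> \<open>Projector \<open>l + 1\<close> comes without a stable estimate, but it is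
    zero.\<close>
  proof (cases "i = l")
    case True
    then have "y = 0" using y p_last[of 0 y] by simp
    then show ?thesis by simp
  next
    case False
    have "F n y = (solution_op A n m ** P m ?j) *v F m y"
      using p_F[OF j, of m y] y solution_op_compose[OF mn, of A]
      by (simp add: matrix_vector_mul_assoc[symmetric]) (simp add: matrix_vector_mul_assoc)
    then have "norm (F n y) \<le> spectral_norm (solution_op A n m ** P m ?j) * norm (F m y)"
      by (metis spectral_norm_bound)
    also have "\<dots> \<le> K * \<sigma>p ?j ^ (n - m) * norm (F m y)"
      using False i by (intro mult_right_mono st mn) auto
    finally show ?thesis .
  qed
  have unstable: "norm (F m x) * \<sigma>m i ^ (n - m) \<le> K * norm (F n x)" if x: "p 0 ?j x = 0" and mn: "m \<le> n" for x m n
  proof -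
    have "solution_op A m n *v F n x = F m x"
      using solution_op_compose[OF mn, of A] solution_op_inverse[of A m n] mn invertible_A
      by (metis matrix_mul_lid matrix_vector_mul_assoc matrix_mul_assoc)
    moreover have "(mat 1 - P n ?j) *v F n x = F n x"
      using p_F[OF j, of n x] x by (simp add: compl_vec)
    ultimately have "F m x = (solution_op A m n ** (mat 1 - P n ?j)) *v F n x"
      by (metis matrix_vector_mul_assoc)
    then have "norm (F m x) \<le> spectral_norm (solution_op A m n ** (mat 1 - P n ?j)) * norm (F n x)"
      by (metis spectral_norm_bound)
    also have "\<dots> \<le> K * \<sigma>m i powi (int m - int n) * norm (F n x)"
      using un[OF mn, of ?j] i by (intro mult_right_mono) auto
    also have "\<sigma>m i powi (int m - int n) = inverse (\<sigma>m i ^ (n - m))"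
      using mn by (simp add: power_int_def nat_diff_distrib flip: power_inverse)
    finally have "norm (F m x) \<le> K * inverse (\<sigma>m i ^ (n - m)) * norm (F n x)" .
    then show ?thesis using \<sigma> by (simp add: field_simps)
  qed
  have "dominated_splitting F (\<lambda>n. p n ?j) ?K ?q"
  proof (intro dominated_splitting.intro dominated_splitting_axioms.intro linear_flow_axioms)
    show "linear (p n ?j)" for n by (rule matrix_vector_mul_linear)
    show "p n ?j (p n ?j x) = p n ?j x" for n x by (rule p_idem[OF j])
    show "p n ?j (F n x) = F n (p 0 ?j x)" for n x by (rule p_F[OF j])
    show "norm (p n ?j x) \<le> ?K * norm x" for n x
    proof (cases "i = l")
      case True
      then show ?thesis using K' p_last[of n x] by simp
    next
      case False
      have "norm (p n ?j x) \<le> spectral_norm (P n ?j) * norm x" by (rule spectral_norm_bound)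
      also have "\<dots> \<le> K * norm x"
        using st[of n n ?j] False i by (intro mult_right_mono) (auto simp: solution_op_self)
      also have "\<dots> \<le> ?K * norm x" using K' by (intro mult_right_mono) auto
      finally show ?thesis .
    qed
    show "0 < ?K" "0 \<le> ?q" "?q < 1" using K' \<sigma> by simp_all
    show "norm (F n y) * norm (F m x) \<le> ?K * ?q ^ (n - m) * (norm (F n x) * norm (F m y))"
      if "p 0 ?j x = 0" "p 0 ?j y = y" "m \<le> n" for x y m n
    proof -
      have "(norm (F n y) * norm (F m x)) * \<sigma>m i ^ (n - m) = norm (F n y) * (norm (F m x) * \<sigma>m i ^ (n - m))"
        by simp
      also have "\<dots> \<le> (K * \<sigma>p ?j ^ (n - m) * norm (F m y)) * (K * norm (F n x))"
        using \<sigma> K by (intro mult_mono stable unstable that) auto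
      also have "\<dots> = (K * K) * \<sigma>p ?j ^ (n - m) * (norm (F n x) * norm (F m y))" by simp
      also have "\<dots> \<le> ?K * \<sigma>p ?j ^ (n - m) * (norm (F n x) * norm (F m y))"
        using K' \<sigma> by (intro mult_right_mono) auto
      finally show ?thesis using \<sigma> by (simp add: power_divide pos_le_divide_eq)
    qed
  qed
  then show ?thesis by blast
qed

sublocale dichotomy_flag F l p
proof
  show "i \<in> {1..l} \<Longrightarrow> \<exists>K q. dominated_splitting F (\<lambda>n. p n (i + 1)) K q" for i
    by (rule dominated_splitting_P)
  show "p 0 1 x = x" "p 0 (l + 1) x = 0" for x by (rule p_first, rule p_last)
  show "\<lbrakk>1 \<le> i; i \<le> j; j \<le> l + 1\<rbrakk> \<Longrightarrow> p 0 i (p 0 j x) = p 0 j x" for i j x using p_comp by blast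
  show "\<lbrakk>1 \<le> i; i \<le> j; j \<le> l + 1\<rbrakk> \<Longrightarrow> p 0 j (p 0 i x) = p 0 j x" for i j x using p_comp by blast
qed

lemma fiber_eq_fib:
  assumes "i \<in> {1..l}"
  shows "fiber P 0 i = fib i"
proof -
  have "x \<in> range ((*v) (mat 1 - P 0 (i + 1))) \<longleftrightarrow> p 0 (i + 1) x = 0" for x
  proof
    assume "x \<in> range ((*v) (mat 1 - P 0 (i + 1)))"
    then obtain z where "x = z - p 0 (i + 1) z" by (auto simp: compl_vec)
    then show "p 0 (i + 1) x = 0"
      using p_idem[of "i + 1" 0 z] assms by (simp add: matrix_vector_mult_diff_distrib)
  next
    assume "p 0 (i + 1) x = 0"
    then have "x = (mat 1 - P 0 (i + 1)) *v x" by (simp add: compl_vec)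
    then show "x \<in> range ((*v) (mat 1 - P 0 (i + 1)))" by blast
  qed
  moreover have "x \<in> range (p 0 i) \<longleftrightarrow> p 0 i x = x" for x using range_p[of i] assms by simp
  ultimately show ?thesis unfolding fiber_def fib_def by blast
qed

text \<open>If the \<open>i\<close>-th fiber were trivial, the dichotomies of the two neighbouring resolvent intervals
  would have the same projectors and hence combine to a dichotomy inside the spectral interval.\<close>

lemma fib_nontrivial:
  assumes i: "i \<in> {1..l}"
  shows "fib i \<noteq> {0}"
proof
  assume triv: "fib i = {0}"
  have i1: "i \<in> {1..l + 1}" "i + 1 \<in> {1..l + 1}" using i by auto
  have "p 0 i x = p 0 (i + 1) x" for x
  proof -
    have "p 0 i x - p 0 (i + 1) x \<in> fib i"
      unfolding fib_def using p_Suc[OF i, of 0 x] p_idem[OF i1(1), of 0 x] p_idem[OF i1(2), of 0 x]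
      by (simp add: matrix_vector_mult_diff_distrib)
    then show ?thesis using triv by simp
  qed
  then have P0: "P 0 i = P 0 (i + 1)" by (simp add: matrix_eq)
  \<comment> \<open>Equality at time 0 spreads to every \<open>n\<close>, since both projectors
    commute with the invertible solution operator.\<close>
  have PP: "P n (i + 1) = P n i" for n
  proof -
    have "solution_op A n 0 ** solution_op A 0 n = mat 1"
      using solution_op_inverse[of A 0 n] invertible_A matrix_left_right_inverse by blast
    moreover have "P n i ** solution_op A n 0 = P n (i + 1) ** solution_op A n 0"
      using P_commute(1)[OF i1(1), of n 0] P_commute(1)[OF i1(2), of n 0] P0 by simp
    ultimately show ?thesis by (metis matrix_mul_assoc matrix_mul_rid)
  qed
  define \<gamma> where "\<gamma> = \<sigma>m i"
  have \<gamma>: "\<gamma> > 0" using \<sigma>m_pos[OF i] by (simp add: \<gamma>_def)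
  obtain \<gamma>1 where \<gamma>1: "0 < \<gamma>1" "\<gamma>1 < \<gamma>" and d1: "exp_dichotomy_with (solution_op (scaled \<gamma>1 A)) (\<lambda>n. P n i)"
    using resolvent_below[OF i] exp_dichotomy_resolvent[OF i1(2)] PP by (auto simp: \<gamma>_def)
  obtain \<gamma>2 where \<gamma>2: "\<gamma> < \<gamma>2" and d2: "exp_dichotomy_with (solution_op (scaled \<gamma>2 A)) (\<lambda>n. P n i)"
    using resolvent_above[OF i] exp_dichotomy_resolvent[OF i1(1)] by (auto simp: \<gamma>_def)
  \<comment> \<open>From the parameter below \<open>\<gamma>\<close> only the stable estimate is
    taken, from the one above only the unstable estimate: passing to \<open>\<gamma>\<close>
    multiplies them by powers of \<open>\<gamma>1 / \<gamma>\<close> and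
    \<open>\<gamma> / \<gamma>2\<close>, both less than 1.\<close>
  obtain K1 \<alpha>1 where K1: "K1 > 0" "\<alpha>1 \<in> {0<..<1}"
    "\<And>m n. m \<le> n \<Longrightarrow> spectral_norm (solution_op (scaled \<gamma>1 A) n m ** P m i) \<le> K1 * \<alpha>1 ^ (n - m)"
    using d1 unfolding exp_dichotomy_with_def by meson
  obtain K2 \<alpha>2 where K2: "K2 > 0" "\<alpha>2 \<in> {0<..<1}"
    "\<And>m n. m \<le> n \<Longrightarrow> spectral_norm (solution_op (scaled \<gamma>2 A) m n ** (mat 1 - P n i)) \<le> K2 * \<alpha>2 ^ (n - m)"
    using d2 unfolding exp_dichotomy_with_def by meson
  have "exp_dichotomy_with (solution_op (scaled \<gamma> A)) (\<lambda>n. P n i)"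
    unfolding exp_dichotomy_with_def
  proof (intro conjI allI)
    show "P n i ** P n i = P n i" for n by (rule P_idem[OF i1(1)])
    have "\<exists>c. solution_op (scaled \<gamma> A) n m = c *\<^sub>R solution_op A n m" for n m
      using solution_op_scaled[of A \<gamma> 1, OF invertible_A \<gamma>, of m n]
        solution_op_scaled[of A \<gamma> 1, OF invertible_A \<gamma>, of n m] by (cases "m \<le> n") (auto simp: scaled_1)
    then show "P n i ** solution_op (scaled \<gamma> A) n m = solution_op (scaled \<gamma> A) n m ** P m i"
      "(mat 1 - P n i) ** solution_op (scaled \<gamma> A) n m = solution_op (scaled \<gamma> A) n m ** (mat 1 - P m i)" for n m
      using P_commute[OF i1(1), of n m] by (metis matrix_scaleR_mult)+
    show "\<exists>K>0. \<exists>\<alpha>s\<in>{0<..<1}. \<exists>\<alpha>u\<in>{0<..<1}. \<forall>m n. m \<le> n \<longrightarrow>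
        spectral_norm (solution_op (scaled \<gamma> A) n m ** P m i) \<le> K * \<alpha>s ^ (n - m) \<and>
        spectral_norm (solution_op (scaled \<gamma> A) m n ** (mat 1 - P n i)) \<le> K * \<alpha>u ^ (n - m)"
    proof (rule exI[of _ "max K1 K2"], rule conjI, use K1 in simp,
        rule bexI[of _ \<alpha>1, OF bexI[of _ \<alpha>2, OF _ K2(2)] K1(2)], intro allI impI conjI)
      fix m n :: nat assume mn: "m \<le> n"
      have "spectral_norm (solution_op (scaled \<gamma> A) n m ** P m i)
          = (\<gamma>1 / \<gamma>) ^ (n - m) * spectral_norm (solution_op (scaled \<gamma>1 A) n m ** P m i)"
        unfolding solution_op_scaled(1)[of A \<gamma> \<gamma>1, OF invertible_A \<gamma> \<gamma>1(1) mn]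
        using \<gamma> \<gamma>1 by (simp add: matrix_scaleR_mult spectral_norm_scaleR)
      also have "\<dots> \<le> 1 * (K1 * \<alpha>1 ^ (n - m))"
        using \<gamma> \<gamma>1 by (intro mult_mono K1 power_le_one mn spectral_norm_nonneg) auto
      also have "\<dots> \<le> max K1 K2 * \<alpha>1 ^ (n - m)" using K1 by (auto intro: mult_right_mono)
      finally show "spectral_norm (solution_op (scaled \<gamma> A) n m ** P m i) \<le> max K1 K2 * \<alpha>1 ^ (n - m)" .
      have "\<gamma>2 > 0" using \<gamma> \<gamma>2 by simp
      have "spectral_norm (solution_op (scaled \<gamma> A) m n ** (mat 1 - P n i))
          = (\<gamma> / \<gamma>2) ^ (n - m) * spectral_norm (solution_op (scaled \<gamma>2 A) m n ** (mat 1 - P n i))"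
        unfolding solution_op_scaled(2)[of A \<gamma> \<gamma>2, OF invertible_A \<gamma> \<open>\<gamma>2 > 0\<close> mn]
        using \<gamma> \<gamma>2 by (simp add: matrix_scaleR_mult spectral_norm_scaleR)
      also have "\<dots> \<le> 1 * (K2 * \<alpha>2 ^ (n - m))"
        using \<gamma> \<gamma>2 by (intro mult_mono K2 power_le_one mn spectral_norm_nonneg) auto
      also have "\<dots> \<le> max K1 K2 * \<alpha>2 ^ (n - m)" using K2 by (auto intro: mult_right_mono)
      finally show "spectral_norm (solution_op (scaled \<gamma> A) m n ** (mat 1 - P n i)) \<le> max K1 K2 * \<alpha>2 ^ (n - m)" .
    qed
  qed
  then have "\<gamma> \<notin> dichotomy_spectrum A" by (auto simp: dichotomy_spectrum_def exp_dichotomy_def)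
  moreover have "\<gamma> \<in> dichotomy_spectrum A"
    using spectrum i \<sigma>_order(2)[OF i] unfolding has_dichotomy_spectrum_def \<gamma>_def by auto
  ultimately show False by simp
qed

section \<open>Return to the angle sums and trace spaces of the theorem\<close>

lemma angle_sum_eq: "angle_sum A (k + 1) (k + n) V = angle_over k (k + n) V"
proof -
  have "angle_sum A (k + 1) (k + n) V =
      (\<Sum>j\<in>{Suc k..<Suc (k + n)}. principal_angle (F (j - 1) ` V) (F j ` V))"
    by (simp add: angle_sum_def atLeastLessThanSuc_atLeastAtMost)
  then show ?thesis
    unfolding sum.shift_bounds_Suc_ivl by (simp add: angle_over_def step_angle_def)
qed

lemma invariant_trace_space:
  assumes "subspace U" "dim U = s" "\<And>j. j \<in> {1..l + 1} \<Longrightarrow> p 0 j ` U \<subseteq> U"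
  shows "U \<in> trace_spaces P l s"
  unfolding trace_spaces_def grassmannian_def
  using assms(1,2) invariant_direct_sum[OF assms(1,3)]
  by (intro CollectI conjI exI[of _ "\<lambda>i. U \<inter> fib i"])
    (auto simp: fiber_eq_fib intro!: subspace_inter subspace_fib)

lemma outer_image_eq:
  assumes s: "1 \<le> s"
    and H: "\<And>V U. \<lbrakk>subspace V; subspace U; 1 \<le> dim V; 1 \<le> dim U;
      \<And>e. e > 0 \<Longrightarrow> \<exists>C. \<forall>k n. \<bar>angle_over k (k + n) V - angle_over k (k + n) U\<bar> \<le> real n * e + C\<rbrakk>
      \<Longrightarrow> H V = H U"
  shows "H ` grassmannian s = H ` trace_spaces P l s"
proof (intro equalityI subsetI)
  fix y assume "y \<in> H ` grassmannian s"
  then obtain V where V: "subspace V" "dim V = s" "y = H V" by (auto simp: grassmannian_def)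
  obtain U where U: "subspace U" "dim U = dim V" "\<And>j. j \<in> {1..l + 1} \<Longrightarrow> p 0 j ` U \<subseteq> U"
    "\<And>e. e > 0 \<Longrightarrow> \<exists>C. \<forall>k n. \<bar>angle_over k (k + n) V - angle_over k (k + n) U\<bar> \<le> real n * e + C"
    using exists_asymptotic_invariant_subspace[OF V(1)] V(2) s by metis
  have "H V = H U" using V U s by (intro H) auto
  moreover have "U \<in> trace_spaces P l s" using V U by (intro invariant_trace_space) auto
  ultimately show "y \<in> H ` trace_spaces P l s" using V(3) by auto
qed (auto simp: trace_spaces_def)

lemma bdd_angle_over:
  assumes "subspace V" "1 \<le> dim V"
  shows "bdd_above (range (\<lambda>k. angle_over k (k + n) V))" "bdd_below (range (\<lambda>k. angle_over k (k + n) V))"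
proof -
  show "bdd_above (range (\<lambda>k. angle_over k (k + n) V))"
  proof (rule bdd_aboveI2)
    show "angle_over k (k + n) V \<le> real n * (pi / 2)" for k
      using angle_over_bounds(2)[OF assms, of k "k + n"] by simp
  qed
  show "bdd_below (range (\<lambda>k. angle_over k (k + n) V))"
    by (rule bdd_belowI2) (rule angle_over_bounds(1)[OF assms])
qed

lemma sup_scaled: "subspace V \<Longrightarrow> 1 \<le> dim V \<Longrightarrow>
    (SUP k. 1 / real n * angle_over k (k + n) V) = (SUP k. angle_over k (k + n) V) / real n"
  by (subst cSUP_cmult) (simp_all add: bdd_angle_over)

lemma inf_scaled: "subspace V \<Longrightarrow> 1 \<le> dim V \<Longrightarrow>
    (INF k. 1 / real n * angle_over k (k + n) V) = (INF k. angle_over k (k + n) V) / real n"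
  by (subst cINF_cmult) (simp_all add: bdd_angle_over)

lemma sup_lines_scaled:
  assumes "lines S \<noteq> {}"
  shows "(SUP v\<in>S - {0}. SUP k. 1 / real n * angle_over k (k + n) (span {v}))
    = (SUP V\<in>lines S. SUP k. angle_over k (k + n) V) / real n"
proof -
  have "(SUP v\<in>S - {0}. SUP k. 1 / real n * angle_over k (k + n) (span {v}))
      = (SUP V\<in>lines S. SUP k. 1 / real n * angle_over k (k + n) V)"
    by (simp add: lines_def image_image)
  also have "\<dots> = (SUP V\<in>lines S. 1 / real n * (SUP k. angle_over k (k + n) V))"
    by (rule SUP_cong) (use lines_dim sup_scaled in auto)
  also have "\<dots> = 1 / real n * (SUP V\<in>lines S. SUP k. angle_over k (k + n) V)"
  proof (rule cSUP_cmult[OF _ assms])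
    have "(SUP k. angle_over k (k + n) V) \<le> real n * (pi / 2)" if "V \<in> lines S" for V
    proof (rule cSUP_least)
      show "angle_over k (k + n) V \<le> real n * (pi / 2)" for k
        using angle_over_bounds(2)[of V k "k + n"] lines_dim[OF that] by simp
    qed simp
    then show "bdd_above ((\<lambda>V. SUP k. angle_over k (k + n) V) ` lines S)" by (rule bdd_aboveI2)
  qed simp
  finally show ?thesis by simp
qed

lemma convergent_outer:
  assumes "subspace V" "1 \<le> dim V"
  shows "convergent (\<lambda>n. (SUP k. angle_over k (k + n) V) / real n)"
  using convergent_sup_angle_over[of "{V}"] assms by simp

lemma lines_fib: "i \<in> {1..l} \<Longrightarrow> lines (fib i) \<noteq> {}"
  using fib_nontrivial[of i] subspace_0[OF subspace_fib, of i] by (auto simp: lines_def)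

end

theorem theorem3p8:
  fixes A :: "nat \<Rightarrow> real ^ 'd ^ 'd"
    and l :: nat
    and \<sigma>m \<sigma>p :: "nat \<Rightarrow> real"
    and P :: "nat \<Rightarrow> nat \<Rightarrow> real ^ 'd ^ 'd"
  assumes "\<forall>n. invertible (A n)"
    and "\<exists>C. \<forall>n. spectral_norm (A n) \<le> C \<and> spectral_norm (matrix_inv (A n)) \<le> C"
    and "has_dichotomy_spectrum A l \<sigma>m \<sigma>p"
    and "dichotomy_projectors A l \<sigma>m \<sigma>p P"
  shows
    "(\<forall>s\<in>{1..CARD('d)}.
        (\<forall>V\<in>grassmannian s.
           convergent (\<lambda>n. 1 / real n * (SUP k. angle_sum A (k + 1) (k + n) V)) \<and>
           convergent (\<lambda>n. 1 / real n * (INF k. angle_sum A (k + 1) (k + n) V))) \<and>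
        (\<forall>V\<in>trace_spaces P l s.
           convergent (\<lambda>n. SUP k. 1 / real n * angle_sum A (k + 1) (k + n) V) \<and>
           convergent (\<lambda>n. INF k. 1 / real n * angle_sum A (k + 1) (k + n) V)) \<and>
        upper_uniform_outer A s =
          (SUP V\<in>trace_spaces P l s.
             lim (\<lambda>n. SUP k. 1 / real n * angle_sum A (k + 1) (k + n) V)) \<and>
        lower_uniform_outer A s =
          (SUP V\<in>trace_spaces P l s.
             lim (\<lambda>n. INF k. 1 / real n * angle_sum A (k + 1) (k + n) V))) \<and>
     convergent (\<lambda>n. 1 / real n *
       (SUP V\<in>grassmannian 1. SUP k. angle_sum A (k + 1) (k + n) V)) \<and>
     (\<forall>i\<in>{1..l}. convergent (\<lambda>n.
        SUP v\<in>fiber P 0 i - {0}. SUP k. 1 / real n * angle_sum A (k + 1) (k + n) (span {v}))) \<and>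
     upper_uniform_inner A 1 = Max ((\<lambda>i. upper_uniform_inner_on A (fiber P 0 i)) ` {1..l})"
proof -
  interpret dichotomy_spectrum_system A l \<sigma>m \<sigma>p P
    using assms by unfold_locales auto
  have gr: "subspace V \<and> 1 \<le> dim V" if "V \<in> grassmannian s" "s \<in> {1..CARD('d)}" for V :: "(real ^ 'd) set" and s
    using that by (auto simp: grassmannian_def)
  have tr: "subspace V \<and> 1 \<le> dim V" if "V \<in> trace_spaces P l s" "s \<in> {1..CARD('d)}" for V s
    using that gr by (auto simp: trace_spaces_def)
  have upper: "upper_uniform_outer A s = (SUP V\<in>trace_spaces P l s.
      lim (\<lambda>n. SUP k. 1 / real n * angle_over k (k + n) V))" if s: "s \<in> {1..CARD('d)}" for s
  proof -
    \<comment> \<open>The simplifier turns \<open>k + 1\<close> into \<open>Suc k\<close>, so the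
      index shift is supplied in simplified form.\<close>
    have "upper_uniform_outer A s = (SUP V\<in>grassmannian s. lim (\<lambda>n. (SUP k. angle_over k (k + n) V) / real n))"
      by (simp add: upper_uniform_outer_def angle_sum_eq[simplified])
    also have "\<dots> = (SUP V\<in>trace_spaces P l s. lim (\<lambda>n. (SUP k. angle_over k (k + n) V) / real n))"
      using s by (intro arg_cong[where f = Sup] outer_image_eq outer_lim_eq_of_close) auto
    also have "\<dots> = (SUP V\<in>trace_spaces P l s. lim (\<lambda>n. SUP k. 1 / real n * angle_over k (k + n) V))"
      by (rule SUP_cong[OF refl]) (use tr[OF _ s] sup_scaled in auto)
    finally show ?thesis .
  qed
  have lower: "lower_uniform_outer A s = (SUP V\<in>trace_spaces P l s.
      lim (\<lambda>n. INF k. 1 / real n * angle_over k (k + n) V))" if s: "s \<in> {1..CARD('d)}" for s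
  proof -
    have "lower_uniform_outer A s = (SUP V\<in>grassmannian s. lim (\<lambda>n. (INF k. angle_over k (k + n) V) / real n))"
      by (simp add: lower_uniform_outer_def angle_sum_eq[simplified])
    also have "\<dots> = (SUP V\<in>trace_spaces P l s. lim (\<lambda>n. (INF k. angle_over k (k + n) V) / real n))"
      using s by (intro arg_cong[where f = Sup] outer_image_eq outer_lim_eq_of_close) auto
    also have "\<dots> = (SUP V\<in>trace_spaces P l s. lim (\<lambda>n. INF k. 1 / real n * angle_over k (k + n) V))"
      by (rule SUP_cong[OF refl]) (use tr[OF _ s] inf_scaled in auto)
    finally show ?thesis .
  qed
  have ne: "lines UNIV \<noteq> {}" using lines_fib[of 1] l by (auto simp: lines_def)
  have rate: "upper_uniform_inner A 1 = growth_rate UNIV"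
    unfolding upper_uniform_inner_def growth_rate_def grassmannian_1 angle_sum_eq by simp
  have rate_on: "upper_uniform_inner_on A (fiber P 0 i) = growth_rate (fib i)" if "i \<in> {1..l}" for i
    unfolding upper_uniform_inner_on_def growth_rate_def angle_sum_eq fiber_eq_fib[OF that]
      sup_lines_scaled[OF lines_fib[OF that]] ..
  have inner: "upper_uniform_inner A 1 = Max ((\<lambda>i. upper_uniform_inner_on A (fiber P 0 i)) ` {1..l})"
  proof -
    have "(\<lambda>i. upper_uniform_inner_on A (fiber P 0 i)) ` {1..l} = (\<lambda>i. growth_rate (fib i)) ` {1..l}"
      by (rule image_cong[OF refl rate_on])
    then show ?thesis using rate growth_rate_UNIV[OF l fib_nontrivial] by simp
  qed
  have conv1: "convergent (\<lambda>n. 1 / real n * (SUP V\<in>grassmannian 1. SUP k. angle_over k (k + n) V))"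
    unfolding grassmannian_1 using convergent_sup_angle_over[OF ne lines_dim] by simp
  have conv_fib: "convergent (\<lambda>n. SUP v\<in>fiber P 0 i - {0}. SUP k. 1 / real n * angle_over k (k + n) (span {v}))"
    if "i \<in> {1..l}" for i
    unfolding fiber_eq_fib[OF that] sup_lines_scaled[OF lines_fib[OF that]]
    using convergent_sup_angle_over[OF lines_fib[OF that] lines_dim] by simp
  show ?thesis
    unfolding angle_sum_eq
  proof (intro conjI ballI conv1 conv_fib inner upper lower)
    fix s assume s: "s \<in> {1..CARD('d)}"
    show "convergent (\<lambda>n. 1 / real n * (SUP k. angle_over k (k + n) V))"
      "convergent (\<lambda>n. 1 / real n * (INF k. angle_over k (k + n) V))" if "V \<in> grassmannian s" for V
      using convergent_outer convergent_inf_angle_over gr[OF that s] by simp_all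
    show "convergent (\<lambda>n. SUP k. 1 / real n * angle_over k (k + n) V)"
      "convergent (\<lambda>n. INF k. 1 / real n * angle_over k (k + n) V)" if "V \<in> trace_spaces P l s" for V
      using convergent_outer convergent_inf_angle_over tr[OF that s] by (simp_all only: sup_scaled inf_scaled)
  qed
qed

end
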